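(* Let $\Pi$ be an LCL problem in rooted regular trees (without inputs). Then $\Pi$ has locality $\Omega(\log n)$ in the LOCAL model if and only if it has locality $\Omega(\log n)$ in the online-LOCAL model.
   Context: An LCL problem in rooted trees is a triple $\Pi=(\delta,\Gamma,C)$ where $\delta\ge 1$ is the number of allowed children, $\Gamma$ is a finite set of output labels, and $C\subseteq\Gamma^{\delta+1}$ is a set of allowed configurations $(a : b_1 b_2\dots b_\delta)$, meaning that a node labeled $a$ may have children labeled $b_1,\dots,b_\delta$ in some order. The inputs are rooted trees in which every non-leaf node has exactly $\delta$ children (no input labels); a labeling is feasible if every node with $\delta$ children, together with its children, forms an allowed configuration. $n$ is the number of nodes, known to algorithms; $B(v,T)$ is the set of nodes within distance $T$ of $v$. LOCAL model with locality $T$: the adversary assigns unique identifiers from $\{1,\dots,\mathrm{poly}(n)\}$; each node outputs a function of its radius-$T$ neighborhood. Online-LOCAL model with locality $T$: the adversary chooses an ordering $v_1,\dots,v_n$ of the nodes; with $G_i = G\bigl[\bigcup_{j\le i}B(v_j,T)\bigr]$, when $v_i$ is presented the algorithm, with unbounded memory, must irrevocably output the label of $v_i$ based on $v_1,\dots,v_i$ and $G_i$. An algorithm solves $\Pi$ if for every input and every adversarial choice the output is feasible. The locality of $\Pi$ in a model is the pointwise smallest function $T(n)$ such that some algorithm in that model solves $\Pi$ with locality at most $T$. *)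

theory Defs
  imports Complex_Main "HOL-Library.Extended_Real" "HOL-Library.Landau_Symbols"
begin

section \<open>Rooted regular trees\<close>

text \<open>Edges are directed from parent to child, so that a subgraph shows the orientation.\<close>

record 'v graph =
  nodes :: "'v set"
  edges :: "('v \<times> 'v) set"

definition rooted_tree :: "'v graph \<Rightarrow> bool" where
  "rooted_tree G \<longleftrightarrow>
     finite (nodes G) \<and> edges G \<subseteq> nodes G \<times> nodes G \<and>
     (\<exists>r\<in>nodes G. (\<forall>u. (u, r) \<notin> edges G) \<and>
        (\<forall>v\<in>nodes G - {r}. \<exists>!u. (u, v) \<in> edges G) \<and>
        (\<forall>v\<in>nodes G. (r, v) \<in> (edges G)\<^sup>*))"

definition children :: "'v graph \<Rightarrow> 'v \<Rightarrow> 'v set" where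
  "children G v = {u. (v, u) \<in> edges G}"

definition regular_tree :: "nat \<Rightarrow> 'v graph \<Rightarrow> bool" where
  "regular_tree d G \<longleftrightarrow>
     rooted_tree G \<and> (\<forall>v\<in>nodes G. children G v \<noteq> {} \<longrightarrow> card (children G v) = d)"

definition ball :: "'v graph \<Rightarrow> 'v \<Rightarrow> nat \<Rightarrow> 'v set" where
  "ball G v t = {u. \<exists>k\<le>t. (v, u) \<in> (edges G \<union> (edges G)\<inverse>) ^^ k}"

definition induced :: "'v graph \<Rightarrow> 'v set \<Rightarrow> 'v graph" where
  "induced G S = \<lparr>nodes = nodes G \<inter> S, edges = edges G \<inter> S \<times> S\<rparr>"

definition rename :: "('v \<Rightarrow> 'w) \<Rightarrow> 'v graph \<Rightarrow> 'w graph" where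
  "rename f G = \<lparr>nodes = f ` nodes G, edges = map_prod f f ` edges G\<rparr>"

section \<open>LCL problems\<close>

text \<open>A configuration \<open>(a : b\<^sub>1 \<dots> b\<^sub>\<delta>)\<close> is the pair of \<open>a\<close> and the list of the \<open>b\<^sub>i\<close>.\<close>

record 'l lcl =
  arity :: nat
  labels :: "'l set"
  configs :: "('l \<times> 'l list) set"

definition lcl_problem :: "'l lcl \<Rightarrow> bool" where
  "lcl_problem P \<longleftrightarrow>
     arity P \<ge> 1 \<and> finite (labels P) \<and>
     configs P \<subseteq> labels P \<times> {bs. set bs \<subseteq> labels P \<and> length bs = arity P}"

definition feasible :: "'l lcl \<Rightarrow> 'v graph \<Rightarrow> ('v \<Rightarrow> 'l) \<Rightarrow> bool" where
  "feasible P G f \<longleftrightarrow>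
     (\<forall>v\<in>nodes G. f v \<in> labels P) \<and>
     (\<forall>v\<in>nodes G. card (children G v) = arity P \<longrightarrow>
        (\<exists>us. distinct us \<and> set us = children G v \<and> (f v, map f us) \<in> configs P))"

section \<open>The LOCAL model\<close>

text \<open>
  Inputs are trees on finite sets of natural numbers. A LOCAL algorithm maps \<open>n\<close>, the
  identifier of the node, and the radius-\<open>T\<close> neighborhood to a label. Nodes of the neighborhood
  are replaced by their identifiers, so nothing else about them is visible.
\<close>

type_synonym 'l local_alg = "nat \<Rightarrow> nat \<Rightarrow> nat graph \<Rightarrow> 'l"

definition local_output ::
  "'l local_alg \<Rightarrow> nat \<Rightarrow> nat graph \<Rightarrow> (nat \<Rightarrow> nat) \<Rightarrow> nat \<Rightarrow> 'l" where
  "local_output A t G ident v =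
     A (card (nodes G)) (ident v) (rename ident (induced G (ball G v t)))"

definition solves_local ::
  "(nat \<Rightarrow> nat) \<Rightarrow> 'l lcl \<Rightarrow> (nat \<Rightarrow> nat) \<Rightarrow> 'l local_alg \<Rightarrow> bool" where
  "solves_local id_bound P T A \<longleftrightarrow>
     (\<forall>G ident. regular_tree (arity P) G \<longrightarrow>
        inj_on ident (nodes G) \<longrightarrow> ident ` nodes G \<subseteq> {1..id_bound (card (nodes G))} \<longrightarrow>
        feasible P G (local_output A (T (card (nodes G))) G ident))"

section \<open>The online-LOCAL model\<close>

text \<open>
  An online-LOCAL algorithm maps \<open>n\<close>, the list \<open>v\<^sub>1, \<dots>, v\<^sub>i\<close> and \<open>G\<^sub>i\<close> to the label
  of \<open>v\<^sub>i\<close>. Memory needs no explicit state: the earlier graphs \<open>G\<^sub>j\<close>, and hence the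
  whole history, are determined by these arguments.
\<close>

type_synonym 'l online_alg = "nat \<Rightarrow> nat list \<Rightarrow> nat graph \<Rightarrow> 'l"

definition online_output ::
  "'l online_alg \<Rightarrow> nat \<Rightarrow> nat graph \<Rightarrow> nat list \<Rightarrow> nat \<Rightarrow> 'l" where
  "online_output A t G vs v =
     (let seen = takeWhile (\<lambda>u. u \<noteq> v) vs @ [v]
      in A (card (nodes G)) seen (induced G (\<Union>u\<in>set seen. ball G u t)))"

definition solves_online ::
  "'l lcl \<Rightarrow> (nat \<Rightarrow> nat) \<Rightarrow> 'l online_alg \<Rightarrow> bool" where
  "solves_online P T A \<longleftrightarrow>
     (\<forall>G vs. regular_tree (arity P) G \<longrightarrow> distinct vs \<longrightarrow> set vs = nodes G \<longrightarrow>
        feasible P G (online_output A (T (card (nodes G))) G vs))"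

section \<open>Locality\<close>

text \<open>
  The locality is \<open>\<infinity>\<close> if no algorithm solves the problem. Otherwise the pointwise infimum
  is attained by a single algorithm, see the lemmas below.
\<close>

definition local_locality :: "(nat \<Rightarrow> nat) \<Rightarrow> 'l lcl \<Rightarrow> nat \<Rightarrow> enat" where
  "local_locality id_bound P n = (INF T\<in>{T. \<exists>A. solves_local id_bound P T A}. enat (T n))"

definition online_locality :: "'l lcl \<Rightarrow> nat \<Rightarrow> enat" where
  "online_locality P n = (INF T\<in>{T. \<exists>A. solves_online P T A}. enat (T n))"

lemma INF_enat_attained:
  assumes "X \<noteq> {}"
  shows "\<exists>T\<in>X. (INF T\<in>X. enat (T n)) = enat (T n)"
proof -
  obtain T0 where "T0 \<in> X" using assms by blast
  then have "(INF T\<in>X. enat (T n)) \<in> (\<lambda>T. enat (T n)) ` X"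
    by (intro wellorder_InfI[of "enat (T0 n)"]) auto
  then show ?thesis by auto
qed

lemma local_locality_attained:
  assumes "solves_local id_bound P T0 A0"
  shows "\<exists>T A. solves_local id_bound P T A \<and> (\<forall>n. local_locality id_bound P n = enat (T n))"
proof -
  have "\<exists>T A. solves_local id_bound P T A \<and> local_locality id_bound P n = enat (T n)" for n
    using INF_enat_attained[of "{T. \<exists>A. solves_local id_bound P T A}" n] assms
    unfolding local_locality_def by blast
  then obtain T A where *: "\<And>n. solves_local id_bound P (T n) (A n)"
    "\<And>n. local_locality id_bound P n = enat (T n n)" by metis
  have "solves_local id_bound P (\<lambda>n. T n n) (\<lambda>n. A n n)"
    using *(1) unfolding solves_local_def local_output_def by blast
  with *(2) show ?thesis by blast
qed

lemma online_locality_attained: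
  assumes "solves_online P T0 A0"
  shows "\<exists>T A. solves_online P T A \<and> (\<forall>n. online_locality P n = enat (T n))"
proof -
  have "\<exists>T A. solves_online P T A \<and> online_locality P n = enat (T n)" for n
    using INF_enat_attained[of "{T. \<exists>A. solves_online P T A}" n] assms
    unfolding online_locality_def by blast
  then obtain T A where *: "\<And>n. solves_online P (T n) (A n)"
    "\<And>n. online_locality P n = enat (T n n)" by metis
  have "solves_online P (\<lambda>n. T n n) (\<lambda>n. A n n)"
    using *(1) unfolding solves_online_def online_output_def by blast
  with *(2) show ?thesis by blast
qed

text \<open>
  Only numbers of nodes that occur are relevant: for other \<open>n\<close> there is no input and both
  localities are \<open>0\<close>, unless they are \<open>\<infinity>\<close> everywhere.
\<close>

definition input_sizes :: "'l lcl \<Rightarrow> nat set" where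
  "input_sizes P = {card (nodes G) | G :: nat graph. regular_tree (arity P) G}"

definition Omega_log :: "nat set \<Rightarrow> (nat \<Rightarrow> enat) \<Rightarrow> bool" where
  "Omega_log S f \<longleftrightarrow>
     (\<exists>c>0. \<forall>\<^sub>F n in sequentially. n \<in> S \<longrightarrow> ereal (c * ln (real n)) \<le> ereal_of_enat (f n))"

end

theory Submission
  imports Defs "HOL-Library.FuncSet" "HOL-Real_Asymp.Real_Asymp"
begin

text \<open>
  An online algorithm simulates a LOCAL algorithm by numbering the nodes in the order of their
  discovery, so only the converse needs an idea. Let an online algorithm have
  locality \<open>t\<close>, less than a small multiple of \<open>log n\<close>, for some large \<open>n\<close>. The adversary shows many
  disjoint complete trees of depth \<open>2t\<close> and presents their nodes of depth \<open>t\<close>. By the pigeonhole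
  principle many of these fragments receive the same set \<open>S\<close> of labels. Hanging such fragments below a
  presented node \<open>x\<close> of another one shows, for all depths \<open>D\<close> between \<open>K = 2t + 2\<close> and \<open>2K\<close>, that the
  complete tree of depth \<open>D\<close> has a labelling of its leaves by \<open>S\<close> that extends to the whole tree for
  every choice of a root label in \<open>S\<close>.

  Given these labelled trees, a LOCAL algorithm only has to cut the input into complete pieces whose
  depths lie between \<open>K\<close> and \<open>2K\<close>. Two Cole--Vishkin steps on the \<open>K\<close>-th power of the root paths give
  \<open>O((log log n)\<^sup>K)\<close> colours, a greedy ruling set then has gaps between \<open>K\<close> and \<open>2K\<close>, and moving it
  downwards by \<open>2K\<close> levels makes all leaves of a piece have the same depth. The locality of this
  algorithm is \<open>o(log n)\<close>.
\<close>

section \<open>Graphs\<close>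

abbreviation adj :: "'v graph \<Rightarrow> ('v \<times> 'v) set" where
  "adj G \<equiv> edges G \<union> (edges G)\<inverse>"

lemma ball_self: "v \<in> ball G v t"
  unfolding ball_def by (auto intro!: exI[of _ 0])

lemma ball_step:
  assumes "u \<in> ball G v i" "(u, w) \<in> adj G"
  shows "w \<in> ball G v (Suc i)"
proof -
  obtain k where "k \<le> i" "(v, u) \<in> adj G ^^ k" using assms(1) unfolding ball_def by blast
  then have "(v, w) \<in> adj G ^^ Suc k" using assms(2) by auto
  with \<open>k \<le> i\<close> show ?thesis unfolding ball_def by (auto intro!: exI[of _ "Suc k"])
qed

lemma ball_mono: "i \<le> j \<Longrightarrow> ball G v i \<subseteq> ball G v j"
  unfolding ball_def using le_trans by blast

lemma ball_subset_nodes: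
  assumes "edges G \<subseteq> nodes G \<times> nodes G" "v \<in> nodes G"
  shows "ball G v t \<subseteq> nodes G"
proof
  fix u assume "u \<in> ball G v t"
  then obtain k where "(v, u) \<in> adj G ^^ k" unfolding ball_def by blast
  then show "u \<in> nodes G" using assms by (induction k arbitrary: u) auto
qed

text \<open>A walk of length \<open>t\<close> only leaves vertices reached in fewer than
  \<open>t\<close> steps, so adjacency matters nowhere else. The hypothesis mentions balls of
  \<open>G\<close> alone, so the ball of \<open>F\<close> need not be known beforehand.\<close>

lemma ball_cong:
  assumes "\<And>u w i. i < t \<Longrightarrow> u \<in> ball G v i \<Longrightarrow> (u, w) \<in> adj G \<longleftrightarrow> (u, w) \<in> adj F"
  shows "ball F v t = ball G v t"
proof -
  have "(v, u) \<in> adj G ^^ k \<longleftrightarrow> (v, u) \<in> adj F ^^ k" if "k \<le> t" for k u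
    using that
  proof (induction k arbitrary: u)
    case (Suc k)
    have *: "(w, u) \<in> adj G \<longleftrightarrow> (w, u) \<in> adj F" if "(v, w) \<in> adj G ^^ k" for w
      using that Suc.prems by (intro assms[of k]) (auto simp: ball_def)
    have IH: "(v, w) \<in> adj G ^^ k \<longleftrightarrow> (v, w) \<in> adj F ^^ k" for w
      using Suc.IH Suc.prems Suc_leD by blast
    show ?case unfolding relpow.simps relcomp_unfold mem_Collect_eq case_prod_conv
      using * IH by blast
  qed simp
  then show ?thesis unfolding ball_def by blast
qed

text \<open>Lets an online algorithm recover the ball of every presented node from the union of
  balls that it sees.\<close>

lemma ball_induced:
  assumes "ball G v t \<subseteq> S"
  shows "ball (induced G S) v t = ball G v t"
proof (rule ball_cong)
  fix u w i assume "i < t" "u \<in> ball G v i"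
  then have "u \<in> S" and "(u, w) \<in> adj G \<Longrightarrow> w \<in> S"
    using assms ball_mono[of i t G v] ball_step[of u G v i w] ball_mono[of "Suc i" t G v]
    by (auto simp: Suc_leI)
  then show "(u, w) \<in> adj G \<longleftrightarrow> (u, w) \<in> adj (induced G S)"
    unfolding induced_def by auto
qed

lemma induced_induced: "S \<subseteq> S' \<Longrightarrow> induced (induced G S') S = induced G S"
  unfolding induced_def by auto

section \<open>Invariance under injective renaming\<close>

lemma edges_rename_iff:
  assumes "inj_on f (nodes G)" "edges G \<subseteq> nodes G \<times> nodes G" "u \<in> nodes G" "v \<in> nodes G"
  shows "(f u, f v) \<in> edges (rename f G) \<longleftrightarrow> (u, v) \<in> edges G"
proof
  assume "(f u, f v) \<in> edges (rename f G)"
  then obtain a b where "(a, b) \<in> edges G" "f u = f a" "f v = f b" unfolding rename_def by auto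
  moreover from this have "a \<in> nodes G" "b \<in> nodes G" using assms(2) by auto
  ultimately show "(u, v) \<in> edges G" using assms inj_onD by metis
qed (auto simp: rename_def)

lemma edges_rename_cases:
  assumes "(a, b) \<in> edges (rename f G)" "edges G \<subseteq> nodes G \<times> nodes G"
  obtains u v where "a = f u" "b = f v" "(u, v) \<in> edges G" "u \<in> nodes G" "v \<in> nodes G"
  using assms unfolding rename_def by auto

lemma nodes_rename [simp]: "nodes (rename f G) = f ` nodes G"
  unfolding rename_def by simp

lemma ball_rename:
  assumes inj: "inj_on f (nodes G)" and E: "edges G \<subseteq> nodes G \<times> nodes G" and v: "v \<in> nodes G"
  shows "ball (rename f G) (f v) t = f ` ball G v t"
proof -
  have *: "(f v, b) \<in> adj (rename f G) ^^ k \<longleftrightarrow> (\<exists>u. (v, u) \<in> adj G ^^ k \<and> b = f u)" for k b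
  proof (induction k arbitrary: b)
    case (Suc k)
    have nd: "u \<in> nodes G" if "(v, u) \<in> adj G ^^ k" for u
      using that v E by (induction k arbitrary: u) auto
    show ?case
    proof
      assume "(f v, b) \<in> adj (rename f G) ^^ Suc k"
      then obtain a where "(f v, a) \<in> adj (rename f G) ^^ k" "(a, b) \<in> adj (rename f G)" by auto
      then obtain u where u: "(v, u) \<in> adj G ^^ k" "a = f u" using Suc by blast
      have "\<exists>w. (u, w) \<in> adj G \<and> b = f w"
      proof (cases "(a, b) \<in> edges (rename f G)")
        case True
        then obtain u' w where "a = f u'" "b = f w" "(u', w) \<in> edges G" "u' \<in> nodes G"
          using edges_rename_cases[OF _ E] by metis
        then show ?thesis using u nd inj by (auto simp: inj_on_def)
      next
        case False
        then have "(b, a) \<in> edges (rename f G)" using \<open>(a, b) \<in> adj _\<close> by auto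
        then obtain w u' where "a = f u'" "b = f w" "(w, u') \<in> edges G" "u' \<in> nodes G"
          using edges_rename_cases[OF _ E] by metis
        then show ?thesis using u nd inj by (auto simp: inj_on_def)
      qed
      then show "\<exists>u. (v, u) \<in> adj G ^^ Suc k \<and> b = f u" using u by auto
    next
      assume "\<exists>u. (v, u) \<in> adj G ^^ Suc k \<and> b = f u"
      then obtain u w where u: "(v, u) \<in> adj G ^^ k" "(u, w) \<in> adj G" "b = f w" by auto
      then have "(f u, f w) \<in> adj (rename f G)" unfolding rename_def by auto
      moreover have "(f v, f u) \<in> adj (rename f G) ^^ k" using Suc u by blast
      ultimately show "(f v, b) \<in> adj (rename f G) ^^ Suc k" using u by auto
    qed
  qed auto
  show ?thesis unfolding ball_def using * by auto
qed

lemma induced_rename: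
  assumes inj: "inj_on f (nodes G)" and E: "edges G \<subseteq> nodes G \<times> nodes G" and S: "S \<subseteq> nodes G"
  shows "induced (rename f G) (f ` S) = rename f (induced G S)"
proof -
  have "f ` nodes G \<inter> f ` S = f ` (nodes G \<inter> S)" using inj S by (auto simp: inj_on_def)
  moreover have "map_prod f f ` edges G \<inter> f ` S \<times> f ` S = map_prod f f ` (edges G \<inter> S \<times> S)"
  proof -
    have S': "a \<in> S" if "f a \<in> f ` S" "a \<in> nodes G" for a
      using that inj S inj_on_image_mem_iff by metis
    have "(a, b) \<in> edges G \<inter> S \<times> S" if "(a, b) \<in> edges G" "f a \<in> f ` S" "f b \<in> f ` S" for a b
      using that S' E by blast
    then show ?thesis by blast
  qed
  ultimately show ?thesis unfolding induced_def rename_def by simp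
qed

lemma children_rename:
  assumes inj: "inj_on f (nodes G)" and E: "edges G \<subseteq> nodes G \<times> nodes G" and v: "v \<in> nodes G"
  shows "children (rename f G) (f v) = f ` children G v"
proof -
  have "b \<in> f ` children G v" if "(f v, b) \<in> edges (rename f G)" for b
  proof -
    obtain x where "b = f x" "x \<in> nodes G" using edges_rename_cases[OF \<open>_ \<in> edges _\<close> E] by metis
    then show ?thesis using that edges_rename_iff[OF inj E v] unfolding children_def by blast
  qed
  moreover have "(f v, f w) \<in> edges (rename f G)" if "(v, w) \<in> edges G" for w
    using that unfolding rename_def by auto
  ultimately show ?thesis unfolding children_def by auto
qed

lemma rooted_treeD:
  assumes "rooted_tree G"
  shows "finite (nodes G)" "edges G \<subseteq> nodes G \<times> nodes G"
    "\<And>u u' v. (u, v) \<in> edges G \<Longrightarrow> (u', v) \<in> edges G \<Longrightarrow> u = u'"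
proof -
  show "finite (nodes G)" "edges G \<subseteq> nodes G \<times> nodes G"
    using assms unfolding rooted_tree_def by auto
  fix u u' v assume "(u, v) \<in> edges G" "(u', v) \<in> edges G"
  with assms show "u = u'" unfolding rooted_tree_def by blast
qed

lemma regular_tree_rename:
  assumes inj: "inj_on f (nodes G)" and reg: "regular_tree d G"
  shows "regular_tree d (rename f G)"
proof -
  have rt: "rooted_tree G" using reg unfolding regular_tree_def by blast
  note E = rooted_treeD(2)[OF rt]
  obtain r where r: "r \<in> nodes G" "\<And>u. (u, r) \<notin> edges G"
    "\<And>v. v \<in> nodes G - {r} \<Longrightarrow> \<exists>!u. (u, v) \<in> edges G"
    "\<And>v. v \<in> nodes G \<Longrightarrow> (r, v) \<in> (edges G)\<^sup>*"
    using rt unfolding rooted_tree_def by metis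
  have "(f r, f v) \<in> (edges (rename f G))\<^sup>*" if "(r, v) \<in> (edges G)\<^sup>*" for v
    using that
  proof induction
    case (step y z)
    then have "(f y, f z) \<in> edges (rename f G)" unfolding rename_def by auto
    with step show ?case by auto
  qed auto
  then have reach: "\<forall>v\<in>nodes (rename f G). (f r, v) \<in> (edges (rename f G))\<^sup>*"
    using r by auto
  have top: "(a, f r) \<notin> edges (rename f G)" for a
  proof
    assume "(a, f r) \<in> edges (rename f G)"
    then obtain u v where "f r = f v" "(u, v) \<in> edges G" "v \<in> nodes G"
      using edges_rename_cases[OF _ E] by metis
    then show False using r(1,2) inj by (metis inj_onD)
  qed
  have par: "\<exists>!u. (u, b) \<in> edges (rename f G)" if "b \<in> f ` nodes G - {f r}" for b
  proof -
    obtain v where v: "v \<in> nodes G" "v \<noteq> r" "b = f v" using \<open>b \<in> f ` nodes G - {f r}\<close> by auto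
    then have "\<exists>!u. (u, v) \<in> edges G" using r(3) by simp
    then obtain u where u: "(u, v) \<in> edges G" "\<And>w. (w, v) \<in> edges G \<Longrightarrow> w = u" by metis
    have "(f u, b) \<in> edges (rename f G)" using u(1) v(3) unfolding rename_def by auto
    moreover have "a = f u" if "(a, b) \<in> edges (rename f G)" for a
    proof -
      obtain w x where wx: "a = f w" "b = f x" "(w, x) \<in> edges G" "x \<in> nodes G"
        using edges_rename_cases[OF \<open>(a, b) \<in> _\<close> E] by metis
      then have "x = v" using v inj by (metis inj_onD)
      then show ?thesis using wx u(2) by blast
    qed
    ultimately show ?thesis by blast
  qed
  have "edges (rename f G) \<subseteq> nodes (rename f G) \<times> nodes (rename f G)"
    using E unfolding rename_def by auto
  then have "rooted_tree (rename f G)"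
    unfolding rooted_tree_def using rooted_treeD(1)[OF rt] r(1) reach top par
    by (intro conjI bexI[of _ "f r"]) simp_all
  moreover have "card (children (rename f G) (f v)) = d"
    if "v \<in> nodes G" "children (rename f G) (f v) \<noteq> {}" for v
  proof -
    have "children G v \<subseteq> nodes G" using E unfolding children_def by auto
    then have "card (f ` children G v) = card (children G v)"
      using inj by (meson card_image inj_on_subset)
    then show ?thesis using that reg children_rename[OF inj E that(1)]
      unfolding regular_tree_def by auto
  qed
  ultimately show ?thesis unfolding regular_tree_def by auto
qed

text \<open>Solutions are found on a renamed copy, whose nodes are codes or identifiers, and are
  pulled back to the original tree.\<close>

lemma feasible_rename:
  assumes inj: "inj_on f (nodes G)" and E: "edges G \<subseteq> nodes G \<times> nodes G"
    and feas: "feasible P (rename f G) h"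
  shows "feasible P G (h \<circ> f)"
  unfolding feasible_def
proof (intro conjI ballI impI)
  fix v assume v: "v \<in> nodes G"
  then show "(h \<circ> f) v \<in> labels P" using feas unfolding feasible_def by auto
  assume card: "card (children G v) = arity P"
  have sub: "children G v \<subseteq> nodes G" using E unfolding children_def by auto
  then have inj': "inj_on f (children G v)" using inj by (meson inj_on_subset)
  have ch: "children (rename f G) (f v) = f ` children G v" by (rule children_rename[OF inj E v])
  then have "card (children (rename f G) (f v)) = arity P" using card inj' by (simp add: card_image)
  then obtain us where us: "distinct us" "set us = f ` children G v" "(h (f v), map h us) \<in> configs P"
    using feas v ch unfolding feasible_def by fastforce
  define ws where "ws = map (the_inv_into (children G v) f) us"
  have fi: "f (the_inv_into (children G v) f u) = u" if "u \<in> set us" for u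
    using that us(2) inj' by (simp add: f_the_inv_into_f)
  have "map f ws = us" unfolding ws_def using fi by (simp add: map_idI)
  moreover have "set ws = children G v"
    unfolding ws_def using us(2) inj' by (auto simp: the_inv_into_f_f image_image)
  moreover have "distinct ws" using us(1) \<open>map f ws = us\<close> by (metis distinct_map)
  ultimately show "\<exists>us. distinct us \<and> set us = children G v \<and> ((h \<circ> f) v, map (h \<circ> f) us) \<in> configs P"
    using us(3) by (intro exI[of _ ws]) (simp flip: map_map)
qed

lemma feasible_cong:
  assumes "feasible P G f" "edges G \<subseteq> nodes G \<times> nodes G" "\<And>v. v \<in> nodes G \<Longrightarrow> h v = f v"
  shows "feasible P G h"
proof -
  have "map h us = map f us" if "set us = children G v" for us v
    using that assms(2,3) unfolding children_def by (auto intro!: map_cong)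
  with assms(1,3) show ?thesis unfolding feasible_def by metis
qed

section \<open>Simulating LOCAL algorithms in the online-LOCAL model\<close>

text \<open>Repetitions count once, so ranks never exceed the number of distinct entries;
  \<open>Suc\<close> makes them start at the least legal identifier.\<close>

definition discovery_rank :: "'a list \<Rightarrow> 'a \<Rightarrow> nat" where
  "discovery_rank xs u = Suc (card (set (takeWhile (\<lambda>x. x \<noteq> u) xs)))"

text \<open>Numbers once given never change when more nodes are discovered; the consistency of the
  simulation rests on this.\<close>

lemma discovery_rank_append:
  "u \<in> set xs \<Longrightarrow> discovery_rank (xs @ ys) u = discovery_rank xs u"
  unfolding discovery_rank_def by (simp add: takeWhile_append1)

lemma discovery_rank_split:
  "u \<notin> set as \<Longrightarrow> discovery_rank (as @ u # bs) u = Suc (card (set as))"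
  unfolding discovery_rank_def by (subst takeWhile_append2) auto

lemma discovery_rank_less:
  assumes "w \<in> set as" "u \<notin> set as"
  shows "discovery_rank (as @ u # bs) w < discovery_rank (as @ u # bs) u"
proof -
  obtain cs ds where as: "as = cs @ w # ds" "w \<notin> set cs" using split_list_first[OF assms(1)] by blast
  then have "discovery_rank (as @ u # bs) w = Suc (card (set cs))"
    using discovery_rank_split[of w cs "ds @ u # bs"] by simp
  moreover have "card (set cs) < card (set as)" by (rule psubset_card_mono) (use as in auto)
  ultimately show ?thesis using discovery_rank_split[OF assms(2)] by simp
qed

lemma inj_on_discovery_rank: "inj_on (discovery_rank xs) (set xs)"
proof (rule inj_onI, rule ccontr)
  fix u w assume uw: "u \<in> set xs" "w \<in> set xs" "discovery_rank xs u = discovery_rank xs w" "u \<noteq> w"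
  obtain as bs where xs: "xs = as @ u # bs" "u \<notin> set as" using split_list_first[OF uw(1)] by blast
  obtain cs ds where xs': "xs = cs @ w # ds" "w \<notin> set cs" using split_list_first[OF uw(2)] by blast
  have "w \<notin> set as" using discovery_rank_less[of w as u bs] xs uw(3) by auto
  have "u \<notin> set cs" using discovery_rank_less[of u cs w ds] xs' uw(3) by auto
  \<comment> \<open>The part of the list before the first occurrence of either node is both
    \<open>as\<close> and \<open>cs\<close>; hence the entry after it is both \<open>u\<close> and
    \<open>w\<close>.\<close>
  have "takeWhile (\<lambda>x. x \<noteq> u \<and> x \<noteq> w) xs = as"
    using xs \<open>w \<notin> set as\<close> by (auto simp: takeWhile_append)
  moreover have "takeWhile (\<lambda>x. x \<noteq> u \<and> x \<noteq> w) xs = cs"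
    using xs' \<open>u \<notin> set cs\<close> by (auto simp: takeWhile_append)
  ultimately show False using xs(1) xs'(1) uw(4) by simp
qed

lemma discovery_rank_le:
  assumes "u \<in> set xs" shows "discovery_rank xs u \<in> {1..card (set xs)}"
proof -
  have "set (takeWhile (\<lambda>x. x \<noteq> u) xs) \<subset> set xs"
    using assms set_takeWhileD by fastforce
  then show ?thesis unfolding discovery_rank_def by (simp add: psubset_card_mono Suc_leI)
qed

definition discovery_list :: "nat \<Rightarrow> nat graph \<Rightarrow> nat list \<Rightarrow> nat list" where
  "discovery_list t G vs = concat (map (\<lambda>v. sorted_list_of_set (ball G v t)) vs)"

definition simulate :: "(nat \<Rightarrow> nat) \<Rightarrow> 'l local_alg \<Rightarrow> 'l online_alg" where
  "simulate T A n seen H =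
     (let ident = discovery_rank (discovery_list (T n) H seen); v = last seen
      in A n (ident v) (rename ident (induced H (ball H v (T n)))))"

lemma rename_cong:
  assumes "edges G \<subseteq> nodes G \<times> nodes G" "\<And>u. u \<in> nodes G \<Longrightarrow> f u = g u"
  shows "rename f G = rename g G"
proof -
  have "map_prod f f ` edges G = map_prod g g ` edges G"
    by (rule image_cong) (use assms in auto)
  then show ?thesis unfolding rename_def using assms(2) by auto
qed

text \<open>When \<open>v\<close> is presented its ball has been discovered, and later discoveries
  only extend the list. So all answers stem from a single identifier assignment, the one given by
  the full list.\<close>

lemma simulate_output:
  fixes G :: "nat graph"
  assumes G: "rooted_tree G" and vs: "set vs = nodes G" and v: "v \<in> nodes G"
  shows "online_output (simulate T A) (T (card (nodes G))) G vs v =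
    local_output A (T (card (nodes G))) G
      (discovery_rank (discovery_list (T (card (nodes G))) G vs)) v"
proof -
  define t where "t = T (card (nodes G))"
  define seen where "seen = takeWhile (\<lambda>u. u \<noteq> v) vs @ [v]"
  define S where "S = (\<Union>u\<in>set seen. ball G u t)"
  note E = rooted_treeD(2)[OF G]
  obtain as bs where "vs = as @ v # bs" "v \<notin> set as" using split_list_first[of v vs] v vs by blast
  then have seen: "vs = seen @ bs" unfolding seen_def by (auto simp: takeWhile_append)
  have sub: "set seen \<subseteq> nodes G" "last seen = v" "v \<in> set seen"
    unfolding seen_def using vs v by (auto dest: set_takeWhileD)
  have balls: "ball (induced G S) u t = ball G u t" if "u \<in> set seen" for u
    by (rule ball_induced) (use that S_def in auto)
  have dl: "discovery_list t (induced G S) seen = discovery_list t G seen"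
    unfolding discovery_list_def using balls by (auto intro!: arg_cong[of _ _ concat])
  have fin: "finite (ball G u t)" if "u \<in> nodes G" for u
    using ball_subset_nodes[OF E that] rooted_treeD(1)[OF G] finite_subset by blast
  have agree: "discovery_rank (discovery_list t G seen) u = discovery_rank (discovery_list t G vs) u"
    if "u \<in> ball G v t" for u
  proof -
    have "discovery_list t G vs = discovery_list t G seen @ discovery_list t G bs"
      unfolding discovery_list_def by (subst seen) simp
    moreover have "u \<in> set (discovery_list t G seen)"
      unfolding discovery_list_def using that sub(3) fin[OF v] by (auto intro!: bexI[of _ v])
    ultimately show ?thesis by (simp add: discovery_rank_append)
  qed
  have ind: "induced (induced G S) (ball G v t) = induced G (ball G v t)"
    by (rule induced_induced) (use S_def sub in auto)
  have "rename (discovery_rank (discovery_list t G seen)) (induced G (ball G v t)) =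
    rename (discovery_rank (discovery_list t G vs)) (induced G (ball G v t))"
    by (rule rename_cong) (use E agree in \<open>auto simp: induced_def\<close>)
  then show ?thesis
    unfolding online_output_def simulate_def local_output_def Let_def
      t_def[symmetric] seen_def[symmetric] S_def[symmetric]
    using balls[OF sub(3)] by (simp add: dl sub ind agree ball_self)
qed

text \<open>Ranks do not exceed the number of nodes, so \<open>n \<le> id_bound n\<close> makes them
  legal identifiers and the LOCAL guarantee applies.\<close>

lemma solves_online_simulate:
  assumes "solves_local id_bound P T A" "\<And>n. n \<le> id_bound n"
  shows "solves_online P T (simulate T A)"
  unfolding solves_online_def
proof (intro allI impI)
  fix G :: "nat graph" and vs assume G: "regular_tree (arity P) G" and vs: "distinct vs" "set vs = nodes G"
  define t where "t = T (card (nodes G))"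
  define ident where "ident = discovery_rank (discovery_list t G vs)"
  have rt: "rooted_tree G" using G unfolding regular_tree_def by blast
  note E = rooted_treeD(2)[OF rt]
  have fin: "finite (ball G u t)" if "u \<in> nodes G" for u
    using ball_subset_nodes[OF E that] rooted_treeD(1)[OF rt] finite_subset by blast
  have "set (discovery_list t G vs) = nodes G"
    unfolding discovery_list_def using vs fin ball_subset_nodes[OF E] ball_self by fastforce
  then have "inj_on ident (nodes G)" "ident ` nodes G \<subseteq> {1..card (nodes G)}"
    unfolding ident_def using inj_on_discovery_rank discovery_rank_le
    by (metis, metis image_subsetI)
  moreover have "{1..card (nodes G)} \<subseteq> {1..id_bound (card (nodes G))}" using assms(2) by auto
  ultimately have "feasible P G (local_output A t G ident)"
    using assms(1) G unfolding solves_local_def t_def by blast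
  moreover have "online_output (simulate T A) t G vs v = local_output A t G ident v"
    if "v \<in> nodes G" for v
    unfolding t_def ident_def by (rule simulate_output[OF rt vs(2) that])
  ultimately have "feasible P G (online_output (simulate T A) t G vs)"
    using feasible_cong[OF _ E] by blast
  then show "feasible P G (online_output (simulate T A) (T (card (nodes G))) G vs)"
    unfolding t_def .
qed

lemma online_locality_le_local_locality:
  assumes "\<And>n. n \<le> id_bound n"
  shows "online_locality P n \<le> local_locality id_bound P n"
  unfolding online_locality_def local_locality_def
  using solves_online_simulate[OF _ assms] by (intro INF_superset_mono) blast+

section \<open>Trees of words\<close>

text \<open>Nodes are addressed by the reversed list of child indices on the path from the root, so the
  children of \<open>w\<close> are \<open>c # w\<close>, and \<open>y @ w\<close> is the descendant of \<open>w\<close> with relative address \<open>y\<close>.\<close>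

definition words :: "nat \<Rightarrow> nat \<Rightarrow> nat list set" where
  "words d m = {w. set w \<subseteq> {..<d} \<and> length w = m}"

definition word_tree :: "nat \<Rightarrow> nat list set \<Rightarrow> bool" where
  "word_tree d H \<longleftrightarrow> finite H \<and> [] \<in> H \<and>
     (\<forall>c w. c # w \<in> H \<longrightarrow> w \<in> H \<and> c < d \<and> (\<forall>c'<d. c' # w \<in> H))"

definition word_graph :: "nat list set \<Rightarrow> nat list graph" where
  "word_graph H = \<lparr>nodes = H, edges = {(w, c # w) | w c. c # w \<in> H}\<rparr>"

lemma word_treeD:
  assumes "word_tree d H"
  shows "finite H" "[] \<in> H" "c # w \<in> H \<Longrightarrow> w \<in> H" "c # w \<in> H \<Longrightarrow> c < d"
    "c # w \<in> H \<Longrightarrow> c' < d \<Longrightarrow> c' # w \<in> H"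
  using assms unfolding word_tree_def by blast+

lemma finite_words: "finite (words d m)"
  unfolding words_def using finite_lists_length_eq[of "{..<d}" m] by simp

lemma card_words: "card (words d m) = d ^ m"
  unfolding words_def using card_lists_length_eq[of "{..<d}" m] by simp

lemma children_word_graph: "children (word_graph H) w = (\<lambda>c. c # w) ` {c. c # w \<in> H}"
  unfolding children_def word_graph_def by auto

lemma children_word_tree:
  assumes "word_tree d H" "c # w \<in> H"
  shows "children (word_graph H) w = (\<lambda>c. c # w) ` {..<d}"
proof -
  have "{c. c # w \<in> H} = {..<d}" using word_treeD(4,5)[OF assms(1)] assms(2) by blast
  then show ?thesis by (simp add: children_word_graph)
qed

lemma edges_word_tree:
  assumes "word_tree d H"
  shows "edges (word_graph H) \<subseteq> nodes (word_graph H) \<times> nodes (word_graph H)"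
  using word_treeD(3)[OF assms] unfolding word_graph_def by auto

lemma regular_word_graph:
  assumes "word_tree d H"
  shows "regular_tree d (word_graph H)"
proof -
  have "([], w) \<in> (edges (word_graph H))\<^sup>*" if "w \<in> H" for w
    using that
  proof (induction w)
    case (Cons c w)
    then have "w \<in> H" "(w, c # w) \<in> edges (word_graph H)"
      using word_treeD(3)[OF assms] unfolding word_graph_def by auto
    with Cons show ?case by (meson rtrancl.rtrancl_into_rtrancl)
  qed simp
  moreover have "\<exists>!u. (u, w) \<in> edges (word_graph H)" if "w \<in> H - {[]}" for w
    using that unfolding word_graph_def by (cases w) auto
  ultimately have "rooted_tree (word_graph H)"
    unfolding rooted_tree_def using word_treeD(1,2)[OF assms] edges_word_tree[OF assms]
    by (intro conjI bexI[of _ "[]"]) (simp_all add: word_graph_def)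
  moreover have "card (children (word_graph H) w) = d" if "children (word_graph H) w \<noteq> {}" for w
  proof -
    obtain c where "c # w \<in> H"
      using \<open>children _ _ \<noteq> {}\<close> by (auto simp: children_word_graph)
    then show ?thesis using children_word_tree[OF assms] by (simp add: card_image inj_on_def)
  qed
  ultimately show ?thesis unfolding regular_tree_def by blast
qed

text \<open>Every node but the root is the child of exactly one node, and each node has
  \<open>0\<close> or \<open>d\<close> children. The congruence allows padding a tree to any
  admissible size.\<close>

lemma card_regular_tree:
  assumes "regular_tree d G"
  shows "\<exists>j. card (nodes G) = 1 + j * d"
proof -
  have rt: "rooted_tree G" using assms unfolding regular_tree_def by blast
  obtain r where r: "r \<in> nodes G" "\<forall>u. (u, r) \<notin> edges G"
    "\<forall>v\<in>nodes G - {r}. \<exists>!u. (u, v) \<in> edges G"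
    using rt unfolding rooted_tree_def by blast
  note fin = rooted_treeD(1)[OF rt] and E = rooted_treeD(2)[OF rt]
  have finc: "finite (children G v)" for v
    by (rule finite_subset[OF _ fin]) (use E in \<open>auto simp: children_def\<close>)
  have "nodes G - {r} = (\<Union>v\<in>nodes G. children G v)"
  proof (intro equalityI subsetI)
    fix v assume "v \<in> nodes G - {r}"
    then obtain u where "(u, v) \<in> edges G" using r(3) by blast
    then show "v \<in> (\<Union>v\<in>nodes G. children G v)" using E unfolding children_def by auto
  qed (use r(2) E in \<open>auto simp: children_def\<close>)
  then have "card (nodes G - {r}) = (\<Sum>v\<in>nodes G. card (children G v))"
    using fin finc rooted_treeD(3)[OF rt]
    by (simp, intro card_UN_disjoint) (auto simp: children_def)
  moreover have "d dvd (\<Sum>v\<in>nodes G. card (children G v))"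
    by (rule dvd_sum) (use assms in \<open>fastforce simp: regular_tree_def\<close>)
  ultimately have "d dvd card (nodes G) - 1" using r(1) fin by simp
  then obtain j where "card (nodes G) - 1 = d * j" by blast
  moreover have "card (nodes G) > 0" using r(1) fin card_gt_0_iff by blast
  ultimately show ?thesis by (intro exI[of _ j]) (simp add: mult.commute)
qed

text \<open>A longest word is a leaf, so \<open>d\<close> children can be attached to it.\<close>

lemma word_tree_extend:
  assumes "word_tree d H"
  shows "\<exists>H'. H \<subseteq> H' \<and> word_tree d H' \<and> card H' = card H + k * d"
proof (induction k)
  case 0
  then show ?case using assms by auto
next
  case (Suc k)
  then obtain H' where H': "H \<subseteq> H'" "word_tree d H'" "card H' = card H + k * d" by blast
  have fin: "finite H'" "[] \<in> H'" using word_treeD(1,2)[OF H'(2)] by auto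
  obtain w where w: "w \<in> H'" "\<And>u. u \<in> H' \<Longrightarrow> length u \<le> length w"
  proof -
    have "Max (length ` H') \<in> length ` H'" using fin by (intro Max_in) auto
    then obtain w where "w \<in> H'" "Max (length ` H') = length w" by blast
    then show ?thesis using Max_ge[of "length ` H'"] fin(1) by (intro that[of w]) auto
  qed
  define N where "N = (\<lambda>c. c # w) ` {..<d}"
  have new: "H' \<inter> N = {}" using w(2) unfolding N_def by fastforce
  have "card (H' \<union> N) = card H' + d"
    using fin new by (simp add: card_Un_disjoint N_def card_image inj_on_def)
  moreover have "word_tree d (H' \<union> N)"
    unfolding word_tree_def
  proof (intro conjI allI impI)
    fix c u assume "c # u \<in> H' \<union> N"
    then show "u \<in> H' \<union> N" "c < d" "\<And>c'. c' < d \<Longrightarrow> c' # u \<in> H' \<union> N"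
      using word_treeD(3-5)[OF H'(2), of c u] w(1) unfolding N_def by auto
  qed (use fin in \<open>auto simp: N_def\<close>)
  ultimately show ?case using H' by (intro exI[of _ "H' \<union> N"]) auto
qed

text \<open>A path of zeros of length \<open>A\<close> with a complete tree of depth
  \<open>B\<close> below each of its nodes. It offers room for an arrangement of fragments near the
  root and for further fragments stored far apart along the path.\<close>

definition spine_tree :: "nat \<Rightarrow> nat \<Rightarrow> nat \<Rightarrow> nat list set" where
  "spine_tree d A B = {y @ replicate a 0 | a y. a \<le> A \<and> set y \<subseteq> {..<d} \<and> length y \<le> B}"

lemma spine_tree_image:
  "spine_tree d A B = (\<lambda>(a, y). y @ replicate a 0) ` ({..A} \<times> {y. set y \<subseteq> {..<d} \<and> length y \<le> B})"
  unfolding spine_tree_def by auto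

lemma card_spine_tree_le:
  assumes "d \<ge> 1"
  shows "card (spine_tree d A B) \<le> (A + 1) * ((B + 1) * d ^ B)"
proof -
  have "card {y. set y \<subseteq> {..<d} \<and> length y \<le> B} = (\<Sum>i\<le>B. d ^ i)"
    by (simp add: card_lists_length_le)
  also have "\<dots> \<le> of_nat (card {..B}) * d ^ B"
    by (rule sum_bounded_above) (use assms in \<open>auto intro: power_increasing\<close>)
  finally have "card ({..A} \<times> {y. set y \<subseteq> {..<d} \<and> length y \<le> B}) \<le> (A + 1) * ((B + 1) * d ^ B)"
    unfolding card_cartesian_product by (intro mult_le_mono) simp_all
  moreover have "finite ({..A} \<times> {y. set y \<subseteq> {..<d} \<and> length y \<le> B})"
    by (simp add: finite_lists_length_le)
  ultimately show ?thesis
    unfolding spine_tree_image using card_image_le le_trans by blast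
qed

lemma word_tree_spine_tree:
  assumes "d \<ge> 1" "B \<ge> 1"
  shows "word_tree d (spine_tree d A B)"
  unfolding word_tree_def
proof (intro conjI allI impI)
  show "finite (spine_tree d A B)"
    unfolding spine_tree_image by (simp add: finite_lists_length_le)
  show "[] \<in> spine_tree d A B" unfolding spine_tree_def by auto
  fix c w assume "c # w \<in> spine_tree d A B"
  then obtain a y where ay: "c # w = y @ replicate a 0" "a \<le> A" "set y \<subseteq> {..<d}" "length y \<le> B"
    unfolding spine_tree_def by blast
  obtain a' y' where w: "w = y' @ replicate a' 0" "a' \<le> A" "set y' \<subseteq> {..<d}" "Suc (length y') \<le> B" "c < d"
  proof (cases y)
    \<comment> \<open>On the path itself the siblings of the word hang from the path by one letter,
      which fits since \<open>B \<ge> 1\<close>.\<close>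
    case Nil
    then have "w = [] @ replicate (a - 1) 0" "c = 0" using ay(1) by (cases a; simp)+
    then show ?thesis using ay assms by (intro that[of "[]" "a - 1"]) auto
  next
    case (Cons x xs)
    then show ?thesis using ay by (intro that[of xs a]) auto
  qed
  then show "c < d" by simp
  show "w \<in> spine_tree d A B" unfolding spine_tree_def using w by fastforce
  fix c' assume "c' < d"
  then have "c' # w = (c' # y') @ replicate a' 0" "set (c' # y') \<subseteq> {..<d}" "length (c' # y') \<le> B"
    using w by auto
  then show "c' # w \<in> spine_tree d A B" unfolding spine_tree_def using w(2) by blast
qed

section \<open>Certificates\<close>

definition allowed :: "'l lcl \<Rightarrow> 'l \<Rightarrow> (nat \<Rightarrow> 'l) \<Rightarrow> bool" where
  "allowed P a b \<longleftrightarrow> (\<exists>us. distinct us \<and> set us = {..<arity P} \<and> (a, map b us) \<in> configs P)"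

definition piece :: "'l lcl \<Rightarrow> nat \<Rightarrow> (nat list \<Rightarrow> 'l) \<Rightarrow> (nat list \<Rightarrow> 'l) \<Rightarrow> bool" where
  "piece P D leaf g \<longleftrightarrow> (\<forall>y\<in>words (arity P) D. g y = leaf y) \<and>
     (\<forall>w. set w \<subseteq> {..<arity P} \<longrightarrow> length w < D \<longrightarrow> allowed P (g w) (\<lambda>c. g (c # w)))"

text \<open>Because \<open>leaf\<close> is chosen before \<open>\<sigma>\<close>, the leaf labels of
  a piece are known without its root label. This breaks the dependence along chains of
  pieces.\<close>

definition certificate :: "'l lcl \<Rightarrow> 'l set \<Rightarrow> nat \<Rightarrow> bool" where
  "certificate P S D \<longleftrightarrow> (\<exists>leaf. (\<forall>y\<in>words (arity P) D. leaf y \<in> S) \<and>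
     (\<forall>\<sigma>\<in>S. \<exists>g. g [] = \<sigma> \<and> piece P D leaf g))"

lemma allowed_labels:
  assumes "lcl_problem P" "allowed P a b"
  shows "a \<in> labels P" "c < arity P \<Longrightarrow> b c \<in> labels P"
  using assms unfolding allowed_def lcl_problem_def by fastforce+

lemma feasible_word_graph_allowed:
  assumes "feasible P (word_graph H) f" "word_tree (arity P) H" "c # w \<in> H"
  shows "allowed P (f w) (\<lambda>c. f (c # w))"
proof -
  have ch: "children (word_graph H) w = (\<lambda>c. c # w) ` {..<arity P}"
    by (rule children_word_tree[OF assms(2,3)])
  have "w \<in> nodes (word_graph H)" using word_treeD(3)[OF assms(2,3)] unfolding word_graph_def by simp
  moreover have "card (children (word_graph H) w) = arity P" unfolding ch by (simp add: card_image inj_on_def)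
  ultimately obtain us where us: "distinct us" "set us = (\<lambda>c. c # w) ` {..<arity P}"
    "(f w, map f us) \<in> configs P"
    using assms(1) ch unfolding feasible_def by metis
  have "map (\<lambda>c. c # w) (map hd us) = us" using us(2) by (auto intro!: map_idI)
  moreover have "distinct (map hd us)" using us(1) calculation by (metis distinct_map)
  moreover have "set (map hd us) = {..<arity P}" using us(2) by (auto simp: image_image)
  moreover have "map (\<lambda>c. f (c # w)) (map hd us) = map f (map (\<lambda>c. c # w) (map hd us))" by simp
  ultimately show ?thesis unfolding allowed_def using us(3)
    by (intro exI[of _ "map hd us"]) (simp del: map_map)
qed

section \<open>The adversary\<close>

text \<open>Codes are even; odd numbers are left for nodes outside the fragments.\<close>

definition code :: "nat \<Rightarrow> nat list \<Rightarrow> nat" where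
  "code i y = 2 * to_nat (i, y)"

lemma code_inject [simp]: "code i y = code i' y' \<longleftrightarrow> i = i' \<and> y = y'"
  unfolding code_def by simp

text \<open>The graph seen by the algorithm while the adversary presents the middle levels of the fragments.\<close>

definition fragments :: "nat \<Rightarrow> nat \<Rightarrow> nat \<Rightarrow> nat graph" where
  "fragments d t N =
     \<lparr>nodes = {code i y | i y. i < N \<and> set y \<subseteq> {..<d} \<and> length y \<le> 2 * t},
      edges = {(code i y, code i (c # y)) | i y c.
                 i < N \<and> set (c # y) \<subseteq> {..<d} \<and> length (c # y) \<le> 2 * t}\<rparr>"

text \<open>Fragment nodes keep the code under which they were shown, wherever the fragment is put,
  so their names reveal nothing about the placement.\<close>

definition placement_name :: "nat \<Rightarrow> nat \<Rightarrow> (nat \<Rightarrow> nat list) \<Rightarrow> nat list \<Rightarrow> nat" where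
  "placement_name t N e w =
     (if \<exists>i y. i < N \<and> length y \<le> 2 * t \<and> w = y @ e i
      then case SOME (i, y). i < N \<and> length y \<le> 2 * t \<and> w = y @ e i of (i, y) \<Rightarrow> code i y
      else 2 * to_nat w + 1)"

text \<open>\<open>e i\<close> is the position of the root of fragment \<open>i\<close> in the tree.
  The bound \<open>2 * t + 1\<close> on one side of \<open>separated\<close> excludes edges between
  fragments as well as overlaps.\<close>

locale placement =
  fixes d t N :: nat and e :: "nat \<Rightarrow> nat list" and H :: "nat list set"
  assumes tree: "word_tree d H"
    and separated: "\<And>i i' y y'. i < N \<Longrightarrow> i' < N \<Longrightarrow> length y \<le> 2 * t + 1 \<Longrightarrow> length y' \<le> 2 * t \<Longrightarrow>
      y @ e i = y' @ e i' \<Longrightarrow> i = i'"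
    and contained: "\<And>i y. i < N \<Longrightarrow> set y \<subseteq> {..<d} \<Longrightarrow> length y \<le> 2 * t \<Longrightarrow> y @ e i \<in> H"
begin

abbreviation "name \<equiv> placement_name t N e"
abbreviation "G \<equiv> rename name (word_graph H)"
abbreviation "F \<equiv> fragments d t N"

section \<open>Faithfulness of the names in a placement\<close>

lemma name_code:
  assumes "i < N" "length y \<le> 2 * t"
  shows "name (y @ e i) = code i y"
proof -
  have "(SOME (j, z). j < N \<and> length z \<le> 2 * t \<and> y @ e i = z @ e j) = (i, y)"
  proof (rule some_equality)
    fix q assume "case q of (j, z) \<Rightarrow> j < N \<and> length z \<le> 2 * t \<and> y @ e i = z @ e j"
    then obtain j z where q: "q = (j, z)" "j < N" "length z \<le> 2 * t" "y @ e i = z @ e j" by auto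
    then have "i = j" using separated[of i j y z] assms by auto
    with q show "q = (i, y)" by simp
  qed (use assms in auto)
  then show ?thesis unfolding placement_name_def using assms by auto
qed

lemma inj_name: "inj name"
proof (rule injI)
  fix w w' assume eq: "name w = name w'"
  have cases: "(\<exists>i y. i < N \<and> length y \<le> 2 * t \<and> w = y @ e i \<and> name w = code i y) \<or> name w = 2 * to_nat w + 1"
    for w
  proof (cases "\<exists>i y. i < N \<and> length y \<le> 2 * t \<and> w = y @ e i")
    case True
    then show ?thesis using name_code by blast
  next
    case False
    then have "name w = 2 * to_nat w + 1" unfolding placement_name_def by (rule if_not_P)
    then show ?thesis ..
  qed
  have odd: "code i y \<noteq> 2 * k + 1" for i y k unfolding code_def by presburger
  show "w = w'" using cases[of w] cases[of w'] eq odd by (auto; metis)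
qed

lemma inj_on_name: "inj_on name (nodes (word_graph H))"
  using inj_name by (rule inj_on_subset) simp

lemma edges_G_iff: "(a, b) \<in> edges G \<longleftrightarrow> (\<exists>w c. c # w \<in> H \<and> a = name w \<and> b = name (c # w))"
  unfolding rename_def word_graph_def by force

section \<open>The view from the middle levels\<close>

lemma adj_F:
  assumes "i < N" "set y \<subseteq> {..<d}" "1 \<le> length y" "length y < 2 * t"
  shows "(code i y, b) \<in> adj F \<longleftrightarrow> (\<exists>c<d. b = code i (c # y)) \<or> b = code i (tl y)"
  using assms unfolding fragments_def by (cases y) auto

text \<open>A node strictly between the top and the bottom level has its parent and all its children
  inside the fragment, so its neighbours are those known from \<open>F\<close>.\<close>

lemma adj_G:
  assumes "i < N" "set y \<subseteq> {..<d}" "1 \<le> length y" "length y < 2 * t"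
  shows "(code i y, b) \<in> adj G \<longleftrightarrow> (\<exists>c<d. b = code i (c # y)) \<or> b = code i (tl y)"
proof -
  obtain c0 z where y: "y = c0 # z" using assms(3) by (cases y) auto
  have nm: "code i y = name (y @ e i)" using name_code assms by simp
  have down: "(code i y, b) \<in> edges G \<longleftrightarrow> (\<exists>c<d. b = code i (c # y))"
  proof
    assume "(code i y, b) \<in> edges G"
    then obtain w c where w: "c # w \<in> H" "code i y = name w" "b = name (c # w)"
      unfolding edges_G_iff by blast
    then have "w = y @ e i" using nm inj_name by (metis injD)
    moreover have "c < d" using tree w(1) unfolding word_tree_def by blast
    moreover have "name ((c # y) @ e i) = code i (c # y)" by (rule name_code) (use assms in auto)
    ultimately show "\<exists>c<d. b = code i (c # y)" using w by auto
  next
    assume "\<exists>c<d. b = code i (c # y)"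
    then obtain c where c: "c < d" "b = code i (c # y)" by blast
    have "(c # y) @ e i \<in> H" by (rule contained) (use assms c in auto)
    moreover have "name ((c # y) @ e i) = b" unfolding c by (rule name_code) (use assms in auto)
    ultimately show "(code i y, b) \<in> edges G"
      unfolding edges_G_iff using nm by (intro exI[of _ "y @ e i"] exI[of _ c]) auto
  qed
  have up: "(b, code i y) \<in> edges G \<longleftrightarrow> b = code i (tl y)"
  proof
    assume "(b, code i y) \<in> edges G"
    then obtain w c where w: "c # w \<in> H" "b = name w" "code i y = name (c # w)"
      unfolding edges_G_iff by blast
    then have "c # w = y @ e i" using nm inj_name by (metis injD)
    then have "w = z @ e i" using y by simp
    then show "b = code i (tl y)" using w y assms name_code[of i z] by simp
  next
    assume "b = code i (tl y)"
    then have "b = name (z @ e i)" using y assms name_code[of i z] by simp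
    moreover have "c0 # z @ e i \<in> H" using contained[of i y] assms y by simp
    ultimately show "(b, code i y) \<in> edges G" unfolding edges_G_iff using nm y by auto
  qed
  show ?thesis using up down by auto
qed

text \<open>Each step changes the depth by one, so starting from depth \<open>t\<close> the first
  \<open>t - 1\<close> steps avoid the top and bottom levels, where \<open>adj_F\<close> ceases to
  apply.\<close>

lemma ball_F_subset:
  assumes "i < N" "p \<in> words d t" "k \<le> t" "u \<in> ball F (code i p) k"
  shows "\<exists>y. u = code i y \<and> set y \<subseteq> {..<d} \<and> t \<le> length y + k \<and> length y \<le> t + k"
proof -
  obtain k' where k': "k' \<le> k" "(code i p, u) \<in> adj F ^^ k'" using assms(4) unfolding ball_def by blast
  have "\<exists>y. u = code i y \<and> set y \<subseteq> {..<d} \<and> t \<le> length y + k' \<and> length y \<le> t + k'"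
    using k'(2) order.trans[OF k'(1) assms(3)]
  proof (induction k' arbitrary: u)
    case 0
    then show ?case using assms(2) unfolding words_def by auto
  next
    case (Suc k')
    then obtain a where a: "(code i p, a) \<in> adj F ^^ k'" "(a, u) \<in> adj F" by auto
    then obtain y where y: "a = code i y" "set y \<subseteq> {..<d}" "t \<le> length y + k'" "length y \<le> t + k'"
      using Suc by fastforce
    then have "(\<exists>c<d. u = code i (c # y)) \<or> u = code i (tl y)"
      using a(2) adj_F[of i y u] assms(1) Suc.prems by simp
    then show ?case
    proof
      assume "\<exists>c<d. u = code i (c # y)"
      then show ?thesis using y by auto
    next
      assume "u = code i (tl y)"
      then show ?thesis using y by (intro exI[of _ "tl y"]) (cases y; auto)
    qed
  qed
  then show ?thesis using k'(1) by auto
qed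

lemma ball_G:
  assumes "i < N" "p \<in> words d t"
  shows "ball G (code i p) t = ball F (code i p) t"
proof (rule ball_cong)
  fix u w k assume k: "k < t" "u \<in> ball F (code i p) k"
  then obtain y where "u = code i y" "set y \<subseteq> {..<d}" "t \<le> length y + k" "length y \<le> t + k"
    using ball_F_subset[OF assms, of k u] by auto
  then show "(u, w) \<in> adj F \<longleftrightarrow> (u, w) \<in> adj G"
    using adj_F[OF assms(1), of y w] adj_G[OF assms(1), of y w] k(1) by simp
qed

lemma ball_F_nodes:
  assumes "i < N" "p \<in> words d t"
  shows "ball F (code i p) t \<subseteq> nodes F"
  using ball_F_subset[OF assms order.refl] assms(1) unfolding fragments_def by fastforce

lemma nodes_F_subset: "nodes F \<subseteq> nodes G"
proof
  fix u assume "u \<in> nodes F"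
  then obtain i y where "u = code i y" "i < N" "set y \<subseteq> {..<d}" "length y \<le> 2 * t"
    unfolding fragments_def by auto
  then have "u = name (y @ e i)" "y @ e i \<in> H" using name_code[of i y] contained[of i y] by auto
  then show "u \<in> nodes G" unfolding word_graph_def by simp
qed

text \<open>An edge of the tree from one fragment to another would equate \<open>c # y\<close> below
  one position with a word below another, contrary to \<open>separated\<close>.\<close>

lemma induced_G:
  assumes "X \<subseteq> nodes F"
  shows "induced G X = induced F X"
proof -
  have "(a, b) \<in> edges G \<longleftrightarrow> (a, b) \<in> edges F" if F: "a \<in> nodes F" "b \<in> nodes F" for a b
  proof -
    obtain i y where a: "a = code i y" "i < N" "set y \<subseteq> {..<d}" "length y \<le> 2 * t"
      using F(1) unfolding fragments_def by auto
    obtain i' y' where b: "b = code i' y'" "i' < N" "set y' \<subseteq> {..<d}" "length y' \<le> 2 * t"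
      using F(2) unfolding fragments_def by auto
    have nm: "a = name (y @ e i)" "b = name (y' @ e i')" using a b name_code by auto
    show ?thesis
    proof
      assume "(a, b) \<in> edges G"
      then obtain w c where w: "a = name w" "b = name (c # w)" unfolding edges_G_iff by blast
      then have eq: "w = y @ e i" "c # w = y' @ e i'" using nm inj_name by (metis injD)+
      then have "(c # y) @ e i = y' @ e i'" by simp
      moreover from this have "i = i'" using separated[of i i' "c # y" y'] a b by simp
      ultimately have "i = i'" "y' = c # y" by auto
      then show "(a, b) \<in> edges F" using a b unfolding fragments_def by auto
    next
      assume "(a, b) \<in> edges F"
      then obtain c where c: "i = i'" "y' = c # y" using a b unfolding fragments_def by auto
      then have "c # y @ e i \<in> H" using contained[of i' y'] b by simp
      then show "(a, b) \<in> edges G" unfolding edges_G_iff using nm c by auto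
    qed
  qed
  then have "edges G \<inter> X \<times> X = edges F \<inter> X \<times> X" using assms by blast
  moreover have "nodes G \<inter> X = nodes F \<inter> X" using assms nodes_F_subset by blast
  ultimately show ?thesis unfolding induced_def by simp
qed

end

text \<open>Depends on the fragments alone, so the adversary knows all answers before it decides how
  to join the fragments.\<close>

definition fragment_answer :: "'l online_alg \<Rightarrow> nat \<Rightarrow> nat \<Rightarrow> nat \<Rightarrow> nat \<Rightarrow> nat list \<Rightarrow> nat \<Rightarrow> 'l" where
  "fragment_answer A n d t N vs v =
     (let seen = takeWhile (\<lambda>u. u \<noteq> v) vs @ [v]
      in A n seen (induced (fragments d t N) (\<Union>u\<in>set seen. ball (fragments d t N) u t)))"

text \<open>The middle nodes \<open>vs\<close> are presented first, then all other nodes in an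
  arbitrary order. Up to the end of \<open>vs\<close> every placement looks like the bare fragments,
  hence the answers coincide.\<close>

lemma placement_labelling:
  assumes pl: "placement (arity P) t N e H" and sol: "solves_online P T A"
    and n: "card H = n" "T n = t"
    and vs: "distinct vs" "set vs = {code i p | i p. i < N \<and> p \<in> words (arity P) t}"
  shows "\<exists>f. feasible P (word_graph H) f \<and>
    (\<forall>i<N. \<forall>p\<in>words (arity P) t. f (p @ e i) = fragment_answer A n (arity P) t N vs (code i p))"
proof -
  interpret placement "arity P" t N e H by (rule pl)
  have reg: "regular_tree (arity P) G"
    by (rule regular_tree_rename[OF inj_on_name regular_word_graph[OF tree]])
  have card: "card (nodes G) = n"
    using inj_on_name n(1) by (simp add: card_image word_graph_def)
  have "finite (nodes G)" using word_treeD(1)[OF tree] unfolding word_graph_def by simp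
  then obtain ws where ws: "distinct ws" "set ws = nodes G - set vs"
    using finite_distinct_list finite_Diff by metis
  have vsF: "set vs \<subseteq> nodes F"
    using vs(2) unfolding fragments_def words_def by auto
  then have all: "distinct (vs @ ws)" "set (vs @ ws) = nodes G"
    using vs(1) ws nodes_F_subset by auto
  define h where "h = online_output A (T (card (nodes G))) G (vs @ ws)"
  have "feasible P G h"
    using sol reg all unfolding solves_online_def h_def by blast
  then have "feasible P (word_graph H) (h \<circ> name)"
    by (rule feasible_rename[OF inj_on_name edges_word_tree[OF tree]])
  moreover have "(h \<circ> name) (p @ e i) = fragment_answer A n (arity P) t N vs (code i p)"
    if ip: "i < N" "p \<in> words (arity P) t" for i p
  proof -
    define seen where "seen = takeWhile (\<lambda>u. u \<noteq> code i p) vs @ [code i p]"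
    have mem: "code i p \<in> set vs" using ip vs(2) by blast
    then have sub: "set seen \<subseteq> set vs" unfolding seen_def by (auto dest: set_takeWhileD)
    have balls: "ball G u t = ball F u t" "ball F u t \<subseteq> nodes F" if u: "u \<in> set seen" for u
    proof -
      obtain j q where "u = code j q" "j < N" "q \<in> words (arity P) t"
        using u sub vs(2) by blast
      then show "ball G u t = ball F u t" "ball F u t \<subseteq> nodes F"
        using ball_G ball_F_nodes by blast+
    qed
    have U: "(\<Union>u\<in>set seen. ball G u t) = (\<Union>u\<in>set seen. ball F u t)" using balls(1) by simp
    have "induced G (\<Union>u\<in>set seen. ball F u t) = induced F (\<Union>u\<in>set seen. ball F u t)"
      by (rule induced_G) (use balls(2) in blast)
    moreover have "takeWhile (\<lambda>u. u \<noteq> code i p) (vs @ ws) = takeWhile (\<lambda>u. u \<noteq> code i p) vs"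
      by (rule takeWhile_append1[OF mem]) simp
    moreover have "name (p @ e i) = code i p"
      by (rule name_code[OF ip(1)]) (use ip(2) in \<open>simp add: words_def\<close>)
    ultimately show ?thesis
      unfolding comp_apply h_def online_output_def fragment_answer_def Let_def card n(2)
      using U by (simp add: seen_def)
  qed
  ultimately show ?thesis by blast
qed

text \<open>Fragment \<open>i0\<close> sits at the root, and below its middle node \<open>p\<close>
  the fragments \<open>idx y\<close> are hung so that their middle levels make up exactly level
  \<open>D\<close> below \<open>p\<close>. The leaf labels do not mention \<open>p\<close>: each
  choice of \<open>p\<close> has its own placement, yet all share these labels.\<close>

lemma placement_piece:
  fixes T :: "nat \<Rightarrow> nat"
  assumes P: "lcl_problem P" and sol: "solves_online P T A"
    and t: "T n = t" and K: "K = 2 * t + 2" and D: "K \<le> D" "D < 2 * K"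
    and H: "word_tree (arity P) H" "card H = n" "spine_tree (arity P) (2 * K + N * K) (3 * K) \<subseteq> H"
    and vs: "distinct vs" "set vs = {code i p | i p. i < N \<and> p \<in> words (arity P) t}"
    and i0: "i0 < N"
    and idx: "inj_on idx (words (arity P) (D - t))" "idx ` words (arity P) (D - t) \<subseteq> {..<N} - {i0}"
    and p: "p \<in> words (arity P) t"
  shows "\<exists>g. g [] = fragment_answer A n (arity P) t N vs (code i0 p) \<and>
    piece P D (\<lambda>z. fragment_answer A n (arity P) t N vs (code (idx (drop t z)) (take t z))) g"
proof -
  define d where "d = arity P"
  define W where "W = words d (D - t)"
  \<comment> \<open>The hung fragments have their roots at depth \<open>D - t\<close> below
    \<open>p\<close>, hence at depth \<open>D\<close> in the tree, since \<open>p\<close> has depth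
    \<open>t\<close>. All other fragments are parked on the path of zeros, at multiples of
    \<open>K\<close> from \<open>3 * K\<close> on.\<close>
  define e where "e = (\<lambda>i. if i = i0 then [] else if i \<in> idx ` W then inv_into W idx i @ p
    else replicate (2 * K + (i + 1) * K) 0)"
  have d: "d \<ge> 1" using P unfolding lcl_problem_def d_def by simp
  have injW: "inj_on idx W" and idxW: "idx ` W \<subseteq> {..<N} - {i0}" and pW: "p \<in> words d t"
    using idx p unfolding W_def d_def by auto
  have lp: "length p = t" "set p \<subseteq> {..<d}" using pW unfolding words_def by auto
  have inv: "inv_into W idx i \<in> W" if "i \<in> idx ` W" for i using that by (rule inv_into_into)
  have len: "length (e i) = (if i = i0 then 0 else if i \<in> idx ` W then D else 2 * K + (i + 1) * K)" for i
    using inv lp K D unfolding e_def W_def words_def by auto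
  have eW: "e (idx y) = y @ p" if "y \<in> W" for y
    using that idxW injW unfolding e_def by auto
  have contained: "y @ e i \<in> H" if "i < N" "set y \<subseteq> {..<d}" "length y \<le> 2 * t" for i y
  proof -
    consider "i = i0" | "i \<noteq> i0" "i \<in> idx ` W" | "i \<noteq> i0" "i \<notin> idx ` W" by blast
    then have "\<exists>a z. y @ e i = z @ replicate a 0 \<and> a \<le> 2 * K + N * K \<and> set z \<subseteq> {..<d} \<and> length z \<le> 3 * K"
    proof cases
      case 1
      then show ?thesis using that K by (intro exI[of _ 0] exI[of _ y]) (auto simp: e_def)
    next
      case 2
      then show ?thesis using that K D lp inv[OF 2(2)] len[of i]
        by (intro exI[of _ 0] exI[of _ "y @ e i"]) (auto simp: e_def W_def words_def)
    next
      case 3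
      have "(i + 1) * K \<le> N * K" using that(1) by (intro mult_le_mono1) simp
      then show ?thesis using that K 3
        by (intro exI[of _ "2 * K + (i + 1) * K"] exI[of _ y]) (simp add: e_def)
    qed
    then show ?thesis using H(3) unfolding spine_tree_def d_def by blast
  qed
  \<comment> \<open>The positions have depth \<open>0\<close>, \<open>D\<close> or a multiple of
    \<open>K\<close> from \<open>3 * K\<close> on, so different depths differ by at least
    \<open>K\<close>, which exceeds \<open>2 * t + 1\<close>.\<close>
  have gap: "length (e i) = length (e i') \<longrightarrow> i = i0 \<or> i \<in> idx ` W \<and> i' \<in> idx ` W"
    "length (e i) < length (e i') \<Longrightarrow> length (e i) + K \<le> length (e i')" if "i \<noteq> i'" for i i'
  proof -
    have *: "(j + 1) * K + K \<le> (j' + 1) * K" if "j < j'" for j j'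
      using mult_le_mono1[of "j + 2" "j' + 1" K] that by simp
    have "K > 0" using K by simp
    show "length (e i) = length (e i') \<longrightarrow> i = i0 \<or> i \<in> idx ` W \<and> i' \<in> idx ` W"
      using that D \<open>K > 0\<close> *[of i i'] *[of i' i] unfolding len
      by (cases i i' rule: linorder_cases) (auto split: if_splits)
    show "length (e i) + K \<le> length (e i')" if "length (e i) < length (e i')"
      using that \<open>i \<noteq> i'\<close> D \<open>K > 0\<close> *[of i i'] *[of i' i] unfolding len
      by (cases i i' rule: linorder_cases) (auto split: if_splits)
  qed
  have sep: "i = i'" if iy: "i < N" "i' < N" "length y \<le> 2 * t + 1" "length y' \<le> 2 * t" "y @ e i = y' @ e i'"
    for i i' y y'
  proof (rule ccontr)
    assume ne: "i \<noteq> i'"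
    have l: "length y + length (e i) = length y' + length (e i')" using iy(5) by (metis length_append)
    then have eqlen: "length (e i) = length (e i')"
      using gap(2)[OF ne] gap(2)[OF ne[symmetric]] iy(3,4) K by (cases "length (e i)" "length (e i')" rule: linorder_cases) auto
    then have eqe: "e i = e i'" using iy(5) by simp
    have "i \<in> idx ` W" "i' \<in> idx ` W"
      using gap(1)[OF ne] gap(1)[OF ne[symmetric]] eqlen ne by auto
    then have "inv_into W idx i = inv_into W idx i'" using eqe eW by (metis append_same_eq f_inv_into_f inv)
    then show False using ne \<open>i \<in> idx ` W\<close> \<open>i' \<in> idx ` W\<close> by (metis f_inv_into_f)
  qed
  have pl: "placement (arity P) t N e H"
    by (rule placement.intro) (use H(1) sep contained d_def in \<open>auto\<close>)
  obtain f where f: "feasible P (word_graph H) f"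
    "\<And>i q. i < N \<Longrightarrow> q \<in> words d t \<Longrightarrow> f (q @ e i) = fragment_answer A n d t N vs (code i q)"
    using placement_labelling[OF pl sol H(2) t vs] unfolding d_def by blast
  define g where "g = (\<lambda>w. f (w @ p))"
  have "g [] = fragment_answer A n d t N vs (code i0 p)"
    using f(2)[OF i0 pW] unfolding g_def e_def by simp
  moreover have "g z = fragment_answer A n d t N vs (code (idx (drop t z)) (take t z))" if "z \<in> words d D" for z
  proof -
    \<comment> \<open>Words have the deepest index first, so \<open>take t z\<close> is the position
      inside the lower fragment and \<open>drop t z\<close> leads from \<open>p\<close> to its
      root.\<close>
    have y: "drop t z \<in> W" "take t z \<in> words d t"
      using that K D unfolding W_def words_def
      by (auto dest: in_set_dropD in_set_takeD)
    have "z @ p = take t z @ e (idx (drop t z))" using eW[OF y(1)] by simp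
    then show ?thesis unfolding g_def using f(2)[OF _ y(2), of "idx (drop t z)"] idxW y(1) by auto
  qed
  moreover have "allowed P (g w) (\<lambda>c. g (c # w))" if "set w \<subseteq> {..<d}" "length w < D" for w
  proof -
    \<comment> \<open>The child \<open>0\<close> shows that \<open>w @ p\<close> is an inner node of
      \<open>H\<close>, where feasibility gives a configuration.\<close>
    have "0 # w @ p = (0 # w @ p) @ replicate 0 0" by simp
    moreover have "set (0 # w @ p) \<subseteq> {..<d}" "length (0 # w @ p) \<le> 3 * K"
      using that lp d K D by auto
    ultimately have "0 # w @ p \<in> H" using H(3) unfolding spine_tree_def d_def by blast
    then show ?thesis using feasible_word_graph_allowed[OF f(1) H(1)] unfolding g_def by simp
  qed
  ultimately show ?thesis unfolding piece_def d_def[symmetric] by blast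
qed

section \<open>From fragments to certificates by the pigeonhole principle\<close>

lemma exists_large_fibre:
  assumes "finite B" "f ` {..<N} \<subseteq> B" "card B * m < N"
  shows "\<exists>b\<in>B. m < card {i. i < N \<and> f i = b}"
proof (rule ccontr)
  assume "\<not> ?thesis"
  then have small: "card {i. i < N \<and> f i = b} \<le> m" if "b \<in> B" for b using that by force
  have "{..<N} = (\<Union>b\<in>B. {i. i < N \<and> f i = b})" using assms(2) by auto
  then have "N \<le> (\<Sum>b\<in>B. card {i. i < N \<and> f i = b})"
    using card_UN_le[OF assms(1), of "\<lambda>b. {i. i < N \<and> f i = b}"] by (metis card_lessThan)
  also have "\<dots> \<le> card B * m" using sum_bounded_above[OF small] by simp
  finally show False using assms(3) by simp
qed

text \<open>There are at most \<open>2 ^ card (labels P)\<close> label sets, so more than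
  \<open>d ^ (2 * K)\<close> fragments share one set \<open>S\<close>. One of them serves as the top
  fragment, and the others suffice for the bottom of a tree of any depth below
  \<open>2 * K\<close>.\<close>

lemma online_certificate:
  fixes T :: "nat \<Rightarrow> nat"
  assumes P: "lcl_problem P" and sol: "solves_online P T A" and n: "n \<in> input_sizes P"
    and K: "K = 2 * T n + 2" and N: "N = 2 ^ card (labels P) * arity P ^ (2 * K) + 1"
    and size: "card (spine_tree (arity P) (2 * K + N * K) (3 * K)) \<le> n"
  shows "\<exists>S. \<forall>D\<in>{K..<2 * K}. certificate P S D"
proof -
  define d where "d = arity P"
  define t where "t = T n"
  have d: "d \<ge> 1" and fin: "finite (labels P)" using P unfolding lcl_problem_def d_def by auto
  define R where "R = spine_tree d (2 * K + N * K) (3 * K)"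
  have R: "word_tree d R" unfolding R_def by (rule word_tree_spine_tree) (use d K in auto)
  obtain j where j: "n = 1 + j * d"
    using n card_regular_tree unfolding input_sizes_def d_def by fastforce
  obtain k where k: "card R = 1 + k * d"
    using card_regular_tree[OF regular_word_graph[OF R]] unfolding word_graph_def by auto
  have "card R \<le> n" using size unfolding R_def d_def .
  \<comment> \<open>Both sizes are \<open>1\<close> modulo \<open>d\<close>, so the padding can
    reach \<open>n\<close> exactly.\<close>
  then have "n = card R + (j - k) * d"
    using j k d by (simp flip: add_mult_distrib)
  then obtain H where H: "R \<subseteq> H" "word_tree d H" "card H = n"
    using word_tree_extend[OF R, of "j - k"] by metis
  have "{code i p | i p. i < N \<and> p \<in> words d t} = (\<lambda>(i, p). code i p) ` ({..<N} \<times> words d t)" by auto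
  then have "finite {code i p | i p. i < N \<and> p \<in> words d t}" using finite_words by simp
  then obtain vs where vs: "distinct vs" "set vs = {code i p | i p. i < N \<and> p \<in> words d t}"
    by (rule exE[OF finite_distinct_list]) blast
  define ans where "ans = (\<lambda>i p. fragment_answer A n d t N vs (code i p))"
  \<comment> \<open>The intersection leaves finitely many possible sets; that leaf labels belong to
    \<open>labels P\<close> is shown below from a piece in which they occur.\<close>
  define L where "L = (\<lambda>i. ans i ` words d t \<inter> labels P)"
  have "L ` {..<N} \<subseteq> Pow (labels P)" unfolding L_def by blast
  moreover have "card (Pow (labels P)) * d ^ (2 * K) < N" using N fin by (simp add: card_Pow d_def)
  ultimately obtain S where S: "d ^ (2 * K) < card {i. i < N \<and> L i = S}"
    using exists_large_fibre[of "Pow (labels P)" L N "d ^ (2 * K)"] fin by blast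
  define I where "I = {i. i < N \<and> L i = S}"
  have "I \<noteq> {}" using S unfolding I_def[symmetric] by auto
  then obtain i0 where i0: "i0 \<in> I" by blast
  have "certificate P S D" if D: "D \<in> {K..<2 * K}" for D
  proof -
    have finI: "finite I" unfolding I_def by simp
    have "card (words d (D - t)) \<le> d ^ (2 * K)"
      unfolding card_words using d D by (intro power_increasing) auto
    also have "\<dots> \<le> card (I - {i0})" using S i0 finI unfolding I_def[symmetric] by simp
    finally obtain idx where idx: "inj_on idx (words d (D - t))" "idx ` words d (D - t) \<subseteq> I - {i0}"
      using card_le_inj[OF finite_words, of "I - {i0}" d "D - t"] finI by blast
    define leaf where "leaf = (\<lambda>z. ans (idx (drop t z)) (take t z))"
    have idx': "idx ` words d (D - t) \<subseteq> {..<N} - {i0}" using idx(2) unfolding I_def by auto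
    have "i0 < N" using i0 unfolding I_def by simp
    have pc: "\<exists>g. g [] = ans i0 p \<and> piece P D leaf g" if "p \<in> words d t" for p
      using placement_piece[OF P sol t_def[symmetric] K[folded t_def] _ _ H(2,3)[unfolded d_def] _ vs[unfolded d_def] \<open>i0 < N\<close>
        idx(1)[unfolded d_def] idx'[unfolded d_def] that[unfolded d_def]] D H(1)
      unfolding leaf_def ans_def R_def d_def by auto
    have "leaf z \<in> S" if z: "z \<in> words d D" for z
    proof -
      \<comment> \<open>An arbitrary middle node, chosen to have some piece in which the parent of
        the leaf \<open>z\<close> forces the label of \<open>z\<close> to be legal.\<close>
      have "replicate t 0 \<in> words d t" using d unfolding words_def by auto
      then obtain g where g: "piece P D leaf g" using pc by blast
      obtain c w where cw: "z = c # w" using z D K unfolding words_def by (cases z) auto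
      have "allowed P (g w) (\<lambda>c. g (c # w))"
        using g z unfolding piece_def words_def cw d_def by auto
      then have "g z \<in> labels P"
        using allowed_labels(2)[OF P, of "g w" "\<lambda>c. g (c # w)" c] z unfolding cw words_def d_def by auto
      then have "leaf z \<in> labels P" using g z unfolding piece_def d_def by simp
      moreover have y: "drop t z \<in> words d (D - t)" "take t z \<in> words d t"
        using z K[folded t_def] D unfolding words_def by (auto dest: in_set_dropD in_set_takeD)
      ultimately have "leaf z \<in> L (idx (drop t z))" unfolding L_def leaf_def by blast
      then show ?thesis using idx(2) y(1) unfolding I_def by auto
    qed
    moreover have "\<exists>g. g [] = \<sigma> \<and> piece P D leaf g" if "\<sigma> \<in> S" for \<sigma>
      using that i0 pc unfolding I_def L_def by auto
    ultimately show ?thesis unfolding certificate_def d_def[symmetric] by blast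
  qed
  then show ?thesis by blast
qed

text \<open>The size is exponential in \<open>t\<close> with a base depending only on the problem.
  Since \<open>K = 2 * (t + 1)\<close>, the factor \<open>(4 * d ^ 5) ^ K\<close> contributes
  \<open>16 * d ^ 10\<close> per unit of \<open>t + 1\<close>, and
  \<open>320 = 20 * 16\<close>.\<close>

lemma spine_tree_size_bound:
  assumes "d \<ge> 1" and K: "K = 2 * t + 2" and N: "N = 2 ^ g * d ^ (2 * K) + 1"
  shows "card (spine_tree d (2 * K + N * K) (3 * K)) \<le> (320 * 2 ^ g * d ^ 10) ^ (t + 1)"
proof -
  have K2: "K \<le> 2 ^ K" using less_exp[of K] by simp
  have "K \<ge> 1" using K by simp
  define M where "M = 2 ^ g * d ^ (2 * K)"
  have M: "M \<ge> 1" unfolding M_def using assms(1) by simp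
  have "2 * K + N * K + 1 \<le> 5 * M * K"
  proof -
    have "K \<le> M * K" using M by simp
    moreover have "2 * K + N * K + 1 = 3 * K + M * K + 1" using N unfolding M_def by (simp add: algebra_simps)
    ultimately show ?thesis using \<open>K \<ge> 1\<close> by linarith
  qed
  also have "\<dots> \<le> 5 * M * 2 ^ K" using K2 by simp
  finally have a: "2 * K + N * K + 1 \<le> 5 * M * 2 ^ K" .
  have "3 * K + 1 \<le> 4 * 2 ^ K" using K2 \<open>K \<ge> 1\<close> by linarith
  then have "(3 * K + 1) * d ^ (3 * K) \<le> 4 * 2 ^ K * d ^ (3 * K)" by (rule mult_le_mono1)
  then have "card (spine_tree d (2 * K + N * K) (3 * K)) \<le> (5 * M * 2 ^ K) * (4 * 2 ^ K * d ^ (3 * K))"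
    using card_spine_tree_le[OF assms(1), of "2 * K + N * K" "3 * K"] a mult_le_mono le_trans by meson
  also have "\<dots> = (20 * 2 ^ g) * (4 * d ^ 5) ^ K"
  proof -
    have "(4::nat) ^ K = 2 ^ K * 2 ^ K" by (simp flip: power_mult_distrib)
    moreover have "d ^ (2 * K) * d ^ (3 * K) = (d ^ 5) ^ K" by (simp flip: power_add power_mult)
    ultimately show ?thesis unfolding M_def power_mult_distrib by (simp add: mult_ac)
  qed
  also have "(4 * d ^ 5) ^ K = (16 * d ^ 10) ^ (t + 1)"
  proof -
    have "K = 2 * (t + 1)" using K by simp
    then have "(4 * d ^ 5) ^ K = ((4 * d ^ 5)\<^sup>2) ^ (t + 1)" by (simp only: power_mult)
    also have "(4 * d ^ 5)\<^sup>2 = 16 * d ^ 10" by (simp add: power_mult_distrib flip: power_mult)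
    finally show ?thesis .
  qed
  also have "(20 * 2 ^ g) * (16 * d ^ 10) ^ (t + 1) \<le> (20 * 2 ^ g) ^ (t + 1) * (16 * d ^ 10) ^ (t + 1)"
    by (intro mult_le_mono1 self_le_power) auto
  also have "\<dots> = (320 * 2 ^ g * d ^ 10) ^ (t + 1)"
  proof -
    have "320 * 2 ^ g * d ^ 10 = (20 * 2 ^ g) * (16 * d ^ 10)" by simp
    then show ?thesis by (simp only: power_mult_distrib)
  qed
  finally show ?thesis .
qed

section \<open>Colour reduction along root paths\<close>

text \<open>Sequences list data of a node (index \<open>0\<close>) and of its ancestors.\<close>

definition locally_distinct :: "nat \<Rightarrow> (nat \<Rightarrow> nat) \<Rightarrow> bool" where
  "locally_distinct K x \<longleftrightarrow> (\<forall>i j. i < j \<longrightarrow> j < i + K \<longrightarrow> x i \<noteq> x j)"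

text \<open>One Cole--Vishkin step, performed against each of the next \<open>K - 1\<close> ancestors.\<close>

definition cv_digit :: "nat \<Rightarrow> nat \<Rightarrow> nat" where
  "cv_digit x y =
     (if x = y then 0 else let i = (LEAST i. bit x i \<noteq> bit y i) in 2 * i + of_bool (bit x i))"

text \<open>Any bijection will do: it turns vectors of digits into colours below
  \<open>b ^ K\<close>.\<close>

definition tuple_code :: "nat \<Rightarrow> nat \<Rightarrow> (nat \<Rightarrow> nat) \<Rightarrow> nat" where
  "tuple_code b K = (SOME h. bij_betw h ({..<K} \<rightarrow>\<^sub>E {..<b}) {..<b ^ K})"

definition cv_reduce :: "nat \<Rightarrow> nat \<Rightarrow> (nat \<Rightarrow> nat) \<Rightarrow> nat \<Rightarrow> nat" where
  "cv_reduce b K x i = tuple_code (2 * b) K (\<lambda>j\<in>{..<K}. cv_digit (x i) (x (i + j)))"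

section \<open>Properness and size of the reduced colouring\<close>

lemma least_differing_bit:
  fixes x y :: nat
  assumes "x \<noteq> y"
  shows "bit x (LEAST i. bit x i \<noteq> bit y i) \<noteq> bit y (LEAST i. bit x i \<noteq> bit y i)"
proof -
  have "\<exists>i. bit x i \<noteq> bit y i" using assms bit_eqI by blast
  then show ?thesis by (rule LeastI_ex)
qed

lemma cv_digit_less:
  assumes "x < 2 ^ b" "y < 2 ^ b" "b \<ge> 1"
  shows "cv_digit x y < 2 * b"
proof (cases "x = y")
  case True
  then show ?thesis using assms by (simp add: cv_digit_def)
next
  case False
  define i where "i = (LEAST i. bit x i \<noteq> bit y i)"
  have "\<not> bit z i" if "z < 2 ^ b" "b \<le> i" for z :: nat
  proof -
    have "(2::nat) ^ b \<le> 2 ^ i" using that by simp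
    then have "z < 2 ^ i" using that by linarith
    then show ?thesis by (simp add: bit_iff_odd)
  qed
  then have "i < b" using least_differing_bit[OF False] assms unfolding i_def by (meson not_le)
  moreover have "cv_digit x y = 2 * i + of_bool (bit x i)"
    using False unfolding cv_digit_def i_def Let_def by simp
  ultimately show ?thesis by (simp add: of_bool_def)
qed

text \<open>Equal digits would name the same bit position with the same value of that bit in
  \<open>x\<close> and \<open>y\<close>, but \<open>x\<close> and \<open>y\<close> differ
  there.\<close>

lemma cv_digit_neq:
  assumes "x \<noteq> y" "y \<noteq> z"
  shows "cv_digit x y \<noteq> cv_digit y z"
proof
  define i where "i = (LEAST i. bit x i \<noteq> bit y i)"
  define j where "j = (LEAST j. bit y j \<noteq> bit z j)"
  assume "cv_digit x y = cv_digit y z"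
  then have "2 * i + of_bool (bit x i) = 2 * j + of_bool (bit y j)"
    using assms by (simp add: cv_digit_def i_def j_def Let_def)
  then have "i = j \<and> (bit x i \<longleftrightarrow> bit y j)"
    by (cases "bit x i"; cases "bit y j"; simp; presburger)
  then have "bit x i = bit y i" by blast
  then show False using least_differing_bit[OF assms(1)] by (simp add: i_def)
qed

lemma bij_betw_tuple_code: "bij_betw (tuple_code b K) ({..<K} \<rightarrow>\<^sub>E {..<b}) {..<b ^ K}"
proof -
  have "finite ({..<K} \<rightarrow>\<^sub>E {..<b})" by (simp add: finite_PiE)
  moreover have "card ({..<K} \<rightarrow>\<^sub>E {..<b}) = card {..<b ^ K}" by (simp add: card_PiE)
  ultimately have "\<exists>h. bij_betw h ({..<K} \<rightarrow>\<^sub>E {..<b}) {..<b ^ K}"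
    using finite_same_card_bij[of "{..<K} \<rightarrow>\<^sub>E {..<b}" "{..<b ^ K}"] by simp
  then show ?thesis unfolding tuple_code_def by (rule someI_ex)
qed

lemma cv_reduce_shift: "cv_reduce b K (\<lambda>i. x (i + m)) i = cv_reduce b K x (i + m)"
  unfolding cv_reduce_def by (simp add: add_ac)

lemma cv_reduce_cong:
  assumes "\<And>j. j < i + K \<Longrightarrow> x j = y j" "K \<ge> 1"
  shows "cv_reduce b K x i = cv_reduce b K y i"
proof -
  have "(\<lambda>j\<in>{..<K}. cv_digit (x i) (x (i + j))) = (\<lambda>j\<in>{..<K}. cv_digit (y i) (y (i + j)))"
    using assms by (intro restrict_ext) simp
  then show ?thesis unfolding cv_reduce_def by simp
qed

text \<open>If \<open>i\<close> and \<open>i + k\<close> had equal new colours, component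
  \<open>k\<close> would contradict \<open>cv_digit_neq\<close> for the entries at \<open>i\<close>,
  \<open>i + k\<close> and \<open>i + 2 * k\<close>.\<close>

lemma cv_reduce_properties:
  assumes "locally_distinct K x" "\<And>i. x i < 2 ^ b" "b \<ge> 1"
  shows "cv_reduce b K x i < (2 * b) ^ K" "locally_distinct K (cv_reduce b K x)"
proof -
  have tup: "(\<lambda>j\<in>{..<K}. cv_digit (x i) (x (i + j))) \<in> {..<K} \<rightarrow>\<^sub>E {..<2 * b}" for i
    using cv_digit_less assms(2,3) by auto
  show "cv_reduce b K x i < (2 * b) ^ K"
    using bij_betwE[OF bij_betw_tuple_code] tup unfolding cv_reduce_def by blast
  show "locally_distinct K (cv_reduce b K x)"
    unfolding locally_distinct_def
  proof (intro allI impI notI)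
    fix i j assume ij: "i < j" "j < i + K" and eq: "cv_reduce b K x i = cv_reduce b K x j"
    define k where "k = j - i"
    have k: "k < K" "k > 0" "j = i + k" using ij unfolding k_def by auto
    have "(\<lambda>j\<in>{..<K}. cv_digit (x i) (x (i + j))) = (\<lambda>l\<in>{..<K}. cv_digit (x j) (x (j + l)))"
      using inj_onD[OF bij_betw_imp_inj_on[OF bij_betw_tuple_code[of "2 * b" K]], OF eq[unfolded cv_reduce_def]] tup
      by blast
    then have "cv_digit (x i) (x (i + k)) = cv_digit (x j) (x (j + k))" using k(1) by (metis lessThan_iff restrict_apply')
    moreover have "x i \<noteq> x j" "x j \<noteq> x (j + k)"
      using assms(1) k ij unfolding locally_distinct_def by auto
    ultimately show False using cv_digit_neq k(3) by metis
  qed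
qed

section \<open>Ruling sets\<close>

text \<open>Greedy choice by colour classes; the two inequalities say that the distance is less than
  \<open>K\<close>. Members of one class may enter together when equal colours are at least
  \<open>K\<close> apart.\<close>

primrec ruling :: "nat \<Rightarrow> (nat \<Rightarrow> nat) \<Rightarrow> nat \<Rightarrow> nat set" where
  "ruling K x 0 = {}"
| "ruling K x (Suc c) =
     ruling K x c \<union> {i. x i = c \<and> (\<forall>j\<in>ruling K x c. \<not> (i < j + K \<and> j < i + K))}"

lemma ruling_separated:
  assumes "locally_distinct K x" "i \<in> ruling K x c" "j \<in> ruling K x c" "i < j"
  shows "i + K \<le> j"
  using assms(2-)
proof (induction c)
  case (Suc c)
  have "x i \<noteq> x j" if "j < i + K" using assms(1) that Suc.prems(3) unfolding locally_distinct_def by blast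
  then show ?case using Suc by (auto simp: not_less) (meson not_less)
qed simp

text \<open>An index is taken in the round of its own colour unless a chosen one is already
  near.\<close>

lemma ruling_dominates:
  assumes "K \<ge> 1" "x i < c"
  shows "\<exists>j\<in>ruling K x c. i < j + K \<and> j < i + K"
  using assms(2)
proof (induction c)
  case (Suc c)
  show ?case
  proof (cases "\<exists>j\<in>ruling K x c. i < j + K \<and> j < i + K")
    case True
    then show ?thesis by auto
  next
    case False
    then have "x i = c" using Suc by (meson less_SucE)
    then have "i \<in> ruling K x (Suc c)" using False by auto
    then show ?thesis using assms(1) by (intro bexI[of _ i]) auto
  qed
qed simp

text \<open>Influence travels less than \<open>K\<close> per round, so from index
  \<open>c * K\<close> on the beginning of the sequence is not felt.\<close>

lemma ruling_shift:
  assumes "c * K \<le> i"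
  shows "i \<in> ruling K (\<lambda>i. x (i + m)) c \<longleftrightarrow> i + m \<in> ruling K x c"
  using assms
proof (induction c arbitrary: i)
  case (Suc c)
  have IH: "j \<in> ruling K (\<lambda>i. x (i + m)) c \<longleftrightarrow> j + m \<in> ruling K x c" if "i < j + K" for j
    using Suc.IH[of j] Suc.prems that by simp
  have "(\<exists>j\<in>ruling K (\<lambda>i. x (i + m)) c. i < j + K \<and> j < i + K) \<longleftrightarrow>
    (\<exists>j\<in>ruling K x c. i + m < j + K \<and> j < i + m + K)" (is "?l \<longleftrightarrow> ?r")
  proof
    assume ?l
    then obtain j where "j \<in> ruling K (\<lambda>i. x (i + m)) c" "i < j + K" "j < i + K" by blast
    then show ?r using IH[of j] by (intro bexI[of _ "j + m"]) auto
  next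
    assume ?r
    then obtain j where j: "j \<in> ruling K x c" "i + m < j + K" "j < i + m + K" by blast
    then have "m \<le> j" using Suc.prems by simp
    then have "j = (j - m) + m" by simp
    then show ?l using IH[of "j - m"] j by (intro bexI[of _ "j - m"]) auto
  qed
  moreover have "i \<in> ruling K (\<lambda>i. x (i + m)) c \<longleftrightarrow> i + m \<in> ruling K x c"
    using Suc.IH[of i] Suc.prems by simp
  ultimately show ?case by auto
qed simp

lemma ruling_cong:
  assumes "\<And>j. j \<le> i + c * K \<Longrightarrow> x j = y j"
  shows "i \<in> ruling K x c \<longleftrightarrow> i \<in> ruling K y c"
  using assms
proof (induction c arbitrary: i)
  case (Suc c)
  have "j \<in> ruling K x c \<longleftrightarrow> j \<in> ruling K y c" if "j < i + K" for j
    by (rule Suc.IH) (use Suc.prems that in auto)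
  moreover have "i \<in> ruling K x c \<longleftrightarrow> i \<in> ruling K y c"
    by (rule Suc.IH) (use Suc.prems in auto)
  moreover have "x i = y i" by (rule Suc.prems) simp
  ultimately show ?case by auto
qed simp

text \<open>The first \<open>q * K\<close> indices are dropped, since there the greedy set may
  depend on where the sequence starts; \<open>q\<close> bounds the number of colours after two
  reductions.\<close>

definition cuts :: "nat \<Rightarrow> nat \<Rightarrow> nat \<Rightarrow> (nat \<Rightarrow> nat) \<Rightarrow> nat set" where
  "cuts b b' K x = (let q = (2 * b') ^ K in
     {m. q * K + m \<in> ruling K (cv_reduce b' K (cv_reduce b K x)) q})"

text \<open>Domination is demanded from \<open>K\<close> on only: the element near a smaller index
  may be among those dropped by \<open>cuts\<close>.\<close>

definition sparse :: "nat \<Rightarrow> nat set \<Rightarrow> bool" where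
  "sparse K C \<longleftrightarrow> (\<forall>i\<in>C. \<forall>j\<in>C. i < j \<longrightarrow> i + K \<le> j) \<and>
     (\<forall>i\<ge>K. \<exists>j\<in>C. i < j + K \<and> j < i + K)"

lemma sparse_cuts:
  assumes "locally_distinct K x" "\<And>i. x i < 2 ^ b" "b \<ge> 1" "b' \<ge> 1" "K \<ge> 1" "(2 * b) ^ K \<le> 2 ^ b'"
  shows "sparse K (cuts b b' K x)"
proof -
  define q where "q = (2 * b') ^ K"
  define y where "y = cv_reduce b' K (cv_reduce b K x)"
  have "cv_reduce b K x i < 2 ^ b'" for i
    using cv_reduce_properties(1)[OF assms(1-3), of i] assms(6) by simp
  then have y: "y i < q" "locally_distinct K y" for i
    using cv_reduce_properties[OF cv_reduce_properties(2)[OF assms(1-3)] _ assms(4)]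
    unfolding y_def q_def by auto
  have C: "cuts b b' K x = {m. q * K + m \<in> ruling K y q}"
    unfolding cuts_def y_def q_def Let_def ..
  have "\<exists>j\<in>cuts b b' K x. i < j + K \<and> j < i + K" if "i \<ge> K" for i
  proof -
    obtain j where j: "j \<in> ruling K y q" "q * K + i < j + K" "j < q * K + i + K"
      using ruling_dominates[of K y "q * K + i" q] assms(5) y(1) by blast
    then have "j = q * K + (j - q * K)" using that by simp
    then have "j - q * K \<in> cuts b b' K x" unfolding C using j(1) by simp
    then show ?thesis using j that by (intro bexI[of _ "j - q * K"]) auto
  qed
  moreover have "i + K \<le> j" if "i \<in> cuts b b' K x" "j \<in> cuts b b' K x" "i < j" for i j
    using ruling_separated[OF y(2), of "q * K + i" q "q * K + j"] that unfolding C by simp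
  ultimately show ?thesis unfolding sparse_def by blast
qed

text \<open>Makes the pieces of parent and child consistent: the sequence of a child is that of its
  parent with one more entry in front, and the offset in \<open>cuts\<close> allows
  \<open>ruling_shift\<close>.\<close>

lemma cuts_Suc:
  assumes "\<And>i. x' (Suc i) = x i"
  shows "Suc m \<in> cuts b b' K x' \<longleftrightarrow> m \<in> cuts b b' K x"
proof -
  define q where "q = (2 * b') ^ K"
  define r where "r = (\<lambda>x. cv_reduce b' K (cv_reduce b K x))"
  have x: "x = (\<lambda>i. x' (i + 1))" using assms by auto
  have "r x = (\<lambda>i. r x' (i + 1))"
    unfolding r_def x cv_reduce_shift[abs_def] ..
  then have "q * K + m \<in> ruling K (r x) q \<longleftrightarrow> q * K + m + 1 \<in> ruling K (r x') q"
    using ruling_shift[of q K "q * K + m" "r x'" 1] by simp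
  then show ?thesis unfolding cuts_def Let_def q_def r_def by simp
qed

text \<open>The reach consists of the offset \<open>q * K\<close>, of \<open>K\<close> for each of
  the \<open>q\<close> greedy rounds and of \<open>K\<close> for each of the two reductions.\<close>

lemma cuts_cong:
  assumes "K \<ge> 1" "q = (2 * b') ^ K" "\<And>j. j < m + 2 * q * K + 2 * K \<Longrightarrow> x j = y j"
  shows "m \<in> cuts b b' K x \<longleftrightarrow> m \<in> cuts b b' K y"
proof -
  have "cv_reduce b K x j = cv_reduce b K y j" if "j < m + 2 * q * K + K" for j
    by (rule cv_reduce_cong) (use assms that in auto)
  then have "cv_reduce b' K (cv_reduce b K x) j = cv_reduce b' K (cv_reduce b K y) j"
    if "j \<le> q * K + m + q * K" for j
    by (intro cv_reduce_cong) (use assms that in auto)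
  then show ?thesis unfolding cuts_def Let_def assms(2)[symmetric] mem_Collect_eq by (rule ruling_cong)
qed

section \<open>Labelling by pieces\<close>

definition consecutive :: "nat set \<Rightarrow> nat \<Rightarrow> nat \<Rightarrow> bool" where
  "consecutive C a b \<longleftrightarrow> a \<in> C \<and> b \<in> C \<and> a < b \<and> (\<forall>c\<in>C. c \<le> a \<or> b \<le> c)"

text \<open>The ancestor at distance \<open>j\<close> is the root of a piece iff \<open>2 * K + j \<in> C\<close>. Because of the shift by
  \<open>2 * K\<close>, a node knows where the next roots below are: they are given by the elements of \<open>C\<close> below
  \<open>2 * K\<close>, which do not depend on the branch. Thus all leaves of a piece have the same depth
  \<open>p - m\<close>.\<close>

definition piece_label ::
  "nat \<Rightarrow> (nat \<Rightarrow> nat list \<Rightarrow> 'l) \<Rightarrow> (nat \<Rightarrow> 'l \<Rightarrow> nat list \<Rightarrow> 'l) \<Rightarrow> nat set \<Rightarrow> (nat \<Rightarrow> nat) \<Rightarrow> 'l" where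
  "piece_label K leaf g C idx =
     (let p = (LEAST p. 2 * K \<le> p \<and> p \<in> C);
          m = (GREATEST m. m < 2 * K \<and> m \<in> C);
          p' = (LEAST p'. p < p' \<and> p' \<in> C)
      in g (p - m) (leaf (p' - p) (map idx [p - 2 * K..<p' - 2 * K])) (map idx [0..<p - 2 * K]))"

lemma piece_label_eq:
  assumes "consecutive C m p" "consecutive C p p'" "m < 2 * K" "2 * K \<le> p"
  shows "piece_label K leaf g C idx =
    g (p - m) (leaf (p' - p) (map idx [p - 2 * K..<p' - 2 * K])) (map idx [0..<p - 2 * K])"
proof -
  have "(LEAST p. 2 * K \<le> p \<and> p \<in> C) = p"
    by (rule Least_equality) (use assms in \<open>fastforce simp: consecutive_def\<close>)+
  moreover have "(GREATEST m. m < 2 * K \<and> m \<in> C) = m"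
    by (rule Greatest_equality) (use assms in \<open>fastforce simp: consecutive_def\<close>)+
  moreover have "(LEAST p'. p < p' \<and> p' \<in> C) = p'"
    by (rule Least_equality) (use assms in \<open>fastforce simp: consecutive_def\<close>)+
  ultimately show ?thesis unfolding piece_label_def by simp
qed

text \<open>Domination at \<open>a + K\<close> yields an element after \<open>a\<close> and before
  \<open>a + 2 * K\<close>.\<close>

lemma consecutive_gap:
  assumes "sparse K C" "consecutive C a b"
  shows "b - a \<in> {K..<2 * K}" "a + (b - a) = b"
proof -
  obtain j where "j \<in> C" "a + K < j + K" "j < a + K + K"
    using assms(1) unfolding sparse_def by (meson le_add2)
  then have "b < a + 2 * K" using assms(2) unfolding consecutive_def by force
  moreover have "a + K \<le> b" "a < b" using assms unfolding sparse_def consecutive_def by blast+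
  ultimately show "b - a \<in> {K..<2 * K}" "a + (b - a) = b" by auto
qed

text \<open>Domination at \<open>p - K\<close>, an index not below \<open>K\<close>, yields an
  element below \<open>p\<close>.\<close>

lemma sparse_predecessor:
  assumes "sparse K C" "2 * K \<le> p" "p \<in> C"
  shows "\<exists>m. consecutive C m p"
proof -
  obtain j where j: "j \<in> C" "p - K < j + K" "j < p - K + K"
    using assms unfolding sparse_def by (metis diff_le_mono mult_2 add_diff_cancel_right')
  define m where "m = Max {c\<in>C. c < p}"
  have "finite {c\<in>C. c < p}" "{c\<in>C. c < p} \<noteq> {}" using j assms(2) by auto
  then have "m \<in> {c\<in>C. c < p}" "\<And>c. c \<in> {c\<in>C. c < p} \<Longrightarrow> c \<le> m"
    unfolding m_def using Max_in Max_ge by blast+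
  then have "consecutive C m p" unfolding consecutive_def using assms(3) by force
  then show ?thesis ..
qed

text \<open>Domination at \<open>3 * K\<close> gives an element between \<open>2 * K\<close> and
  \<open>4 * K\<close>, and the gap bound controls the next one. All data of a label thus lie below
  \<open>6 * K\<close>.\<close>

lemma sparse_pieces:
  assumes "sparse K C" "K \<ge> 1"
  obtains m p p' where "consecutive C m p" "consecutive C p p'" "m < 2 * K" "2 * K \<le> p" "p < 4 * K" "p' < 6 * K"
proof -
  have near: "\<exists>j\<in>C. i < j + K \<and> j < i + K" if "i \<ge> K" for i using assms that unfolding sparse_def by blast
  define p where "p = (LEAST p. 2 * K \<le> p \<and> p \<in> C)"
  obtain k where k: "k \<in> C" "3 * K < k + K" "k < 3 * K + K" using near[of "3 * K"] by auto
  then have "\<exists>p. 2 * K \<le> p \<and> p \<in> C" by (intro exI[of _ k]) auto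
  then have p: "2 * K \<le> p" "p \<in> C" unfolding p_def by (metis (mono_tags, lifting) LeastI_ex)+
  have pl: "p \<le> j" if "2 * K \<le> j" "j \<in> C" for j unfolding p_def using that by (simp add: Least_le)
  have "p < 4 * K" using k pl[of k] by simp
  obtain m where m: "consecutive C m p" using sparse_predecessor[OF assms(1) p] by blast
  have "m < 2 * K"
    using m pl[of m] unfolding consecutive_def by force
  define p' where "p' = (LEAST j. p < j \<and> j \<in> C)"
  obtain l where "l \<in> C" "p + K < l + K" using near[of "p + K"] by auto
  then have "\<exists>j. p < j \<and> j \<in> C" by auto
  then have p': "p < p'" "p' \<in> C" unfolding p'_def by (metis (mono_tags, lifting) LeastI_ex)+
  have "p' \<le> j" if "p < j" "j \<in> C" for j unfolding p'_def using that by (simp add: Least_le)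
  then have c': "consecutive C p p'" unfolding consecutive_def using p p' by (auto simp: not_le[symmetric])
  have "p' < 6 * K" using consecutive_gap[OF assms(1) c'] \<open>p < 4 * K\<close> by auto
  show ?thesis by (rule that) fact+
qed

lemma consecutive_cong:
  assumes "consecutive C a b" "\<And>c. c \<le> b \<Longrightarrow> c \<in> C \<longleftrightarrow> c \<in> C'"
  shows "consecutive C' a b"
  using assms unfolding consecutive_def by (metis le_less_linear less_imp_le)

lemma piece_label_cong:
  assumes "sparse K C" "K \<ge> 1" "\<And>c. c < 6 * K \<Longrightarrow> c \<in> C \<longleftrightarrow> c \<in> C'" "\<And>i. i < 6 * K \<Longrightarrow> idx i = idx' i"
  shows "piece_label K leaf g C' idx' = piece_label K leaf g C idx"
proof -
  obtain m p p' where c: "consecutive C m p" "consecutive C p p'" and b: "m < 2 * K" "2 * K \<le> p" "p < 4 * K" "p' < 6 * K"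
    using sparse_pieces[OF assms(1,2)] by metis
  have c': "consecutive C' m p" "consecutive C' p p'"
    by (rule consecutive_cong[OF c(1)], use assms(3) b in simp)
      (rule consecutive_cong[OF c(2)], use assms(3) b in simp)
  have "map idx' [p - 2 * K..<p' - 2 * K] = map idx [p - 2 * K..<p' - 2 * K]"
    "map idx' [0..<p - 2 * K] = map idx [0..<p - 2 * K]"
    using assms(4) b by auto
  then show ?thesis unfolding piece_label_eq[OF c b(1,2)] piece_label_eq[OF c' b(1,2)] by (simp only:)
qed

lemma consecutive_Suc:
  assumes "consecutive C a b" "\<And>m. Suc m \<in> C' \<longleftrightarrow> m \<in> C"
  shows "consecutive C' (Suc a) (Suc b)"
  unfolding consecutive_def
proof (intro conjI ballI)
  fix c assume "c \<in> C'"
  then show "c \<le> Suc a \<or> Suc b \<le> c" using assms unfolding consecutive_def by (cases c) auto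
qed (use assms in \<open>auto simp: consecutive_def\<close>)

lemma map_upt_Suc_shift:
  assumes "\<And>i. idx' (Suc i) = idx i"
  shows "map idx' [Suc a..<Suc b] = map idx [a..<b]"
  using assms by (simp add: map_Suc_upt[symmetric] del: upt_Suc)

text \<open>\<open>h\<close> is built from the data of the parent, so it serves all children at
  once. A child either stays in the piece of its parent, with an address longer by one letter, or is
  a leaf of that piece and the root of the next one.\<close>

lemma piece_label_step:
  fixes leaf :: "nat \<Rightarrow> nat list \<Rightarrow> 'l"
  assumes "K \<ge> 1" "sparse K C"
    and S: "\<And>D y. D \<in> {K..<2 * K} \<Longrightarrow> y \<in> words (arity P) D \<Longrightarrow> leaf D y \<in> S"
    and g: "\<And>D \<sigma>. D \<in> {K..<2 * K} \<Longrightarrow> \<sigma> \<in> S \<Longrightarrow> g D \<sigma> [] = \<sigma> \<and> piece P D (leaf D) (g D \<sigma>)"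
    and idx: "\<And>i. idx i < arity P"
  shows "\<exists>h. allowed P (piece_label K leaf g C idx) h \<and>
    (\<forall>C' idx'. sparse K C' \<longrightarrow> (\<forall>m. Suc m \<in> C' \<longleftrightarrow> m \<in> C) \<longrightarrow>
      (\<forall>i. idx' (Suc i) = idx i) \<longrightarrow> idx' 0 < arity P \<longrightarrow>
      piece_label K leaf g C' idx' = h (idx' 0))"
proof -
  obtain m p p' where c: "consecutive C m p" "consecutive C p p'" and b: "m < 2 * K" "2 * K \<le> p"
    using sparse_pieces[OF assms(2,1)] by metis
  define D where "D = p - m"
  define D' where "D' = p' - p"
  define j where "j = p - 2 * K"
  \<comment> \<open>The root label of a piece is a leaf label of the piece above, available without
    the root label of that piece.\<close>
  define \<rho> where "\<rho> = leaf D' (map idx [j..<p' - 2 * K])"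
  define w where "w = map idx [0..<j]"
  have D: "D \<in> {K..<2 * K}" "D' \<in> {K..<2 * K}"
    unfolding D_def D'_def using consecutive_gap[OF assms(2)] c by blast+
  have "map idx [j..<p' - 2 * K] \<in> words (arity P) D'"
    unfolding words_def D'_def j_def using idx b(2) c(2) by (auto simp: consecutive_def)
  then have \<rho>: "\<rho> \<in> S" unfolding \<rho>_def by (rule S[OF D(2)])
  have pc: "piece P D (leaf D) (g D \<rho>)" using g[OF D(1) \<rho>] by simp
  have w: "set w \<subseteq> {..<arity P}" "length w < D"
    unfolding w_def D_def j_def using idx b by auto
  have lab: "piece_label K leaf g C idx = g D \<rho> w"
    unfolding piece_label_eq[OF c b] \<rho>_def D_def D'_def w_def j_def ..
  have child: "piece_label K leaf g C' idx' = g D \<rho> (idx' 0 # w)"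
    if sp: "sparse K C'" and C': "\<And>m. Suc m \<in> C' \<longleftrightarrow> m \<in> C"
      and idx': "\<And>i. idx' (Suc i) = idx i" and a: "idx' 0 < arity P" for C' idx'
  proof (cases "m = 2 * K - 1")
    case False
    then have b': "Suc m < 2 * K" "2 * K \<le> Suc p" using b by auto
    have "map idx' [0..<Suc j] = idx' 0 # map idx' [Suc 0..<Suc j]" by (simp add: upt_rec  del: upt_Suc)
    then have aw: "map idx' [0..<Suc j] = idx' 0 # w"
      unfolding w_def using map_upt_Suc_shift[of idx' idx 0 j] idx' by simp
    have "p \<le> p'" using c(2) unfolding consecutive_def by simp
    then have sub: "Suc p - 2 * K = Suc j" "Suc p' - 2 * K = Suc (p' - 2 * K)" using b(2) unfolding j_def by auto
    show ?thesis
      unfolding piece_label_eq[OF consecutive_Suc[OF c(1) C'] consecutive_Suc[OF c(2) C'] b']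
        sub aw \<rho>_def D_def D'_def map_upt_Suc_shift[of idx' idx, OF idx'] by simp
  next
    \<comment> \<open>The shift moves the cut \<open>m\<close> to \<open>2 * K\<close>, so the child
      is a root. As a root and as a leaf of the piece of its parent it gets the same label, the
      value of \<open>leaf D\<close> at its address.\<close>
    case True
    have c1: "consecutive C' (2 * K) (Suc p)"
      using consecutive_Suc[OF c(1) C'] True assms(1) by simp
    have "2 * K \<in> C'" using c1 unfolding consecutive_def by simp
    then obtain m' where m': "consecutive C' m' (2 * K)"
      using sparse_predecessor[OF sp, of "2 * K"] by auto
    then have "m' < 2 * K" unfolding consecutive_def by simp
    have Dj: "Suc p - 2 * K = D" "D = Suc j" unfolding D_def j_def using True b assms(1) by auto
    have "map idx' [0..<Suc j] = idx' 0 # map idx' [Suc 0..<Suc j]" by (simp add: upt_rec  del: upt_Suc)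
    then have aw: "map idx' [0..<D] = idx' 0 # w"
      unfolding w_def Dj(2) using map_upt_Suc_shift[of idx' idx 0 j] idx' by simp
    have word: "idx' 0 # w \<in> words (arity P) D" unfolding words_def Dj(2) using w a unfolding w_def by simp
    have "piece_label K leaf g C' idx' = g (2 * K - m') (leaf D (idx' 0 # w)) []"
      unfolding piece_label_eq[OF m' c1 \<open>m' < 2 * K\<close> order.refl] by (simp add: Dj(1) aw)
    also have "\<dots> = leaf D (idx' 0 # w)"
      using g[OF consecutive_gap(1)[OF sp m'] S[OF D(1) word]] by simp
    also have "\<dots> = g D \<rho> (idx' 0 # w)" using pc word unfolding piece_def by simp
    finally show ?thesis .
  qed
  have "allowed P (g D \<rho> w) (\<lambda>a. g D \<rho> (a # w))" using pc w unfolding piece_def by blast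
  then show ?thesis using lab child by (intro exI[of _ "\<lambda>a. g D \<rho> (a # w)"]) auto
qed

section \<open>The LOCAL algorithm\<close>

text \<open>The root is continued upwards by a cyclic path of \<open>K\<close> virtual ancestors
  \<open>B + 1, \<dots>, B + K\<close>.\<close>

definition tree_parent :: "nat \<Rightarrow> nat \<Rightarrow> nat graph \<Rightarrow> nat \<Rightarrow> nat" where
  "tree_parent B K G v =
     (if \<exists>u. (u, v) \<in> edges G then THE u. (u, v) \<in> edges G
      else if v \<le> B then B + 1 else B + 1 + (v - B) mod K)"

definition ancestors :: "nat \<Rightarrow> nat \<Rightarrow> nat graph \<Rightarrow> nat \<Rightarrow> nat \<Rightarrow> nat" where
  "ancestors B K G v i = (tree_parent B K G ^^ i) v"

text \<open>The rank among siblings ordered by identifier. A node without parent gets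
  \<open>0\<close>, which is a legal index.\<close>

definition child_index :: "nat graph \<Rightarrow> nat \<Rightarrow> nat" where
  "child_index G v = card {w. w < v \<and> (\<exists>p. (p, v) \<in> edges G \<and> (p, w) \<in> edges G)}"

definition tree_label ::
  "nat \<Rightarrow> nat \<Rightarrow> nat \<Rightarrow> nat \<Rightarrow> (nat \<Rightarrow> nat list \<Rightarrow> 'l) \<Rightarrow> (nat \<Rightarrow> 'l \<Rightarrow> nat list \<Rightarrow> 'l) \<Rightarrow> nat graph \<Rightarrow> nat \<Rightarrow> 'l" where
  "tree_label B b b' K leaf g G v =
     piece_label K leaf g (cuts b b' K (ancestors B K G v)) (\<lambda>i. child_index G (ancestors B K G v i))"

text \<open>A cycle through a node also passes through its unique parent, hence climbs to the root,
  which has no incoming edge.\<close>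

lemma rooted_tree_acyclic:
  assumes "rooted_tree G"
  shows "(v, v) \<notin> (edges G)\<^sup>+"
proof
  assume cyc: "(v, v) \<in> (edges G)\<^sup>+"
  obtain r where r: "\<And>u. (u, r) \<notin> edges G" "\<And>v. v \<in> nodes G \<Longrightarrow> (r, v) \<in> (edges G)\<^sup>*"
    using assms unfolding rooted_tree_def by metis
  have "v \<in> nodes G" using cyc rooted_treeD(2)[OF assms] by (meson SigmaD2 subsetD tranclD2)
  then have "(r, v) \<in> (edges G)\<^sup>*" by (rule r(2))
  then have "(v, v) \<notin> (edges G)\<^sup>+"
  proof induction
    case base
    then show ?case using r(1) by (meson tranclD2)
  next
    case (step y z)
    show ?case
    proof
      assume "(z, z) \<in> (edges G)\<^sup>+"
      then obtain p where p: "(z, p) \<in> (edges G)\<^sup>*" "(p, z) \<in> edges G" by (meson tranclD2)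
      then have "p = y" using rooted_treeD(3)[OF assms] step(2) by blast
      then have "(y, y) \<in> (edges G)\<^sup>+" using p step(2) by (meson rtrancl_into_trancl2)
      then show False using step by simp
    qed
  qed
  then show False using cyc by simp
qed

text \<open>Nodes are their own identifiers here, so numbers above \<open>B\<close> are free for
  virtual ancestors.\<close>

locale id_tree =
  fixes d B K :: nat and G :: "nat graph"
  assumes reg: "regular_tree d G" and ids: "nodes G \<subseteq> {1..B}" and d: "d \<ge> 1" and K: "K \<ge> 1"
begin

abbreviation "par \<equiv> tree_parent B K G"
abbreviation "anc \<equiv> ancestors B K G"

lemma rt: "rooted_tree G" using reg unfolding regular_tree_def by blast

lemmas E = rooted_treeD(2)[OF rt]

lemma edge_bounds: "(u, v) \<in> edges G \<Longrightarrow> u \<le> B \<and> v \<le> B \<and> u \<in> nodes G \<and> v \<in> nodes G"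
  using E ids by fastforce

lemma par_edge: "(u, v) \<in> edges G \<Longrightarrow> par v = u"
  unfolding tree_parent_def using rooted_treeD(3)[OF rt] by (auto intro!: the_equality)

lemma par_virtual: "v > B \<Longrightarrow> par v = B + 1 + (v - B) mod K"
  unfolding tree_parent_def using edge_bounds by fastforce

lemma par_real: "v \<le> B \<Longrightarrow> (par v, v) \<in> edges G \<or> par v = B + 1"
proof (cases "\<exists>u. (u, v) \<in> edges G")
  case True
  then show ?thesis using par_edge by blast
qed (simp add: tree_parent_def)

lemma par_range:
  assumes "v \<in> nodes G \<or> B < v \<and> v \<le> B + K"
  shows "par v \<in> nodes G \<or> B < par v \<and> par v \<le> B + K"
proof (cases "v \<le> B")
  case True
  then show ?thesis using par_real[OF True] edge_bounds K by auto
next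
  case False
  then show ?thesis using par_virtual[of v] K mod_less_divisor[of K "v - B"]
    by (simp del: mod_less_divisor)
qed

lemma anc_0: "anc v 0 = v" and anc_Suc: "anc v (Suc i) = par (anc v i)"
  unfolding ancestors_def by auto

lemma anc_add: "anc v (i + j) = anc (anc v i) j"
  unfolding ancestors_def by (simp add: funpow_add add.commute[of i j])

lemma anc_child: "(u, v) \<in> edges G \<Longrightarrow> anc v (Suc i) = anc u i"
  using anc_add[of v 1 i] par_edge by (simp add: anc_0 anc_Suc)

lemma anc_range:
  assumes "v \<in> nodes G"
  shows "anc v i \<in> nodes G \<or> B < anc v i \<and> anc v i \<le> B + K"
proof (induction i)
  case (Suc i)
  show ?case unfolding anc_Suc by (rule par_range[OF Suc.IH])
qed (simp add: anc_0 assms)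

lemma anc_le: "v \<in> nodes G \<Longrightarrow> anc v i \<le> B + K"
  using anc_range[of v i] ids by fastforce

lemma anc_virtual: "anc (B + 1 + m) i = B + 1 + (m + i) mod K" if "m < K"
proof (induction i)
  case 0
  then show ?case using that by (simp add: anc_0)
next
  case (Suc i)
  then show ?case using par_virtual[of "B + 1 + (m + i) mod K"]
    by (simp add: anc_Suc mod_Suc_eq)
qed

lemma anc_above: "B < v \<Longrightarrow> B < anc v i"
  by (induction i) (auto simp: anc_0 anc_Suc par_virtual)

lemma anc_path: "anc v i \<le> B \<Longrightarrow> (anc v i, v) \<in> (edges G)\<^sup>*"
proof (induction i)
  case (Suc i)
  have "anc v i \<le> B" using Suc.prems par_virtual[of "anc v i"] by (fastforce simp: anc_Suc)
  then show ?case using Suc par_real[of "anc v i"] by (auto simp: anc_Suc intro: converse_rtrancl_into_rtrancl)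
qed (simp add: anc_0)

text \<open>A return to a real node would close a directed cycle in the tree; a return to a virtual
  one would go round the cycle of \<open>K\<close> virtual ancestors in fewer than \<open>K\<close>
  steps.\<close>

lemma anc_neq:
  assumes "v \<in> nodes G \<or> B < v \<and> v \<le> B + K" "0 < k" "k < K"
  shows "anc v k \<noteq> v"
proof
  assume eq: "anc v k = v"
  show False
  proof (cases "v \<le> B")
    case True
    have "anc v k = anc (par v) (k - 1)" using anc_add[of v 1 "k - 1"] assms(2) by (simp add: anc_0 anc_Suc)
    then have "\<not> B < par v" using anc_above[of "par v" "k - 1"] eq True by auto
    then have "(par v, v) \<in> edges G" using par_real[OF True] by auto
    moreover have "(v, par v) \<in> (edges G)\<^sup>*"
      using anc_path[of "par v" "k - 1"] \<open>anc v k = anc (par v) (k - 1)\<close> eq True by simp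
    ultimately have "(v, v) \<in> (edges G)\<^sup>+" by (rule rtrancl_into_trancl1[rotated])
    then show False using rooted_tree_acyclic[OF rt] by blast
  next
    case False
    define m where "m = v - B - 1"
    have m: "v = B + 1 + m" "m < K" using False assms(1) ids unfolding m_def by auto
    then have "(m + k) mod K = m" using anc_virtual[OF m(2), of k] eq by simp
    then have "(m + k) mod K = m mod K" using m(2) by simp
    then have "K dvd k" by (simp add: mod_eq_dvd_iff_nat)
    then show False using assms(2,3) by (simp add: nat_dvd_not_less)
  qed
qed

lemma locally_distinct_anc:
  assumes "v \<in> nodes G"
  shows "locally_distinct K (anc v)"
  unfolding locally_distinct_def
proof (intro allI impI)
  fix i j assume "i < j" "j < i + K"
  then show "anc v i \<noteq> anc v j"
    using anc_neq[OF anc_range[OF assms, of i], of "j - i"] anc_add[of v i "j - i"] by force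
qed

section \<open>Numbering of the children\<close>

lemma finite_children: "finite (children G v)"
  by (rule finite_subset[OF _ rooted_treeD(1)[OF rt]]) (use E in \<open>auto simp: children_def\<close>)

lemma child_index_child:
  "(u, v) \<in> edges G \<Longrightarrow> child_index G v = card {w \<in> children G u. w < v}"
  unfolding child_index_def children_def using rooted_treeD(3)[OF rt]
  by (intro arg_cong[of _ _ card]) blast

lemma child_index_less: "child_index G v < d"
proof (cases "\<exists>u. (u, v) \<in> edges G")
  case True
  then obtain u where u: "(u, v) \<in> edges G" by blast
  then have "v \<in> children G u" by (simp add: children_def)
  then have "{w \<in> children G u. w < v} \<subset> children G u" by blast
  then have "child_index G v < card (children G u)"
    unfolding child_index_child[OF u] by (rule psubset_card_mono[OF finite_children])
  moreover have "card (children G u) = d"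
    using reg \<open>v \<in> children G u\<close> edge_bounds[OF u] unfolding regular_tree_def by blast
  ultimately show ?thesis by simp
next
  case False
  then have "child_index G v = 0" unfolding child_index_def by simp
  then show ?thesis using d by simp
qed

lemma bij_betw_child_index:
  assumes "card (children G u) = d"
  shows "bij_betw (child_index G) (children G u) {..<d}"
proof -
  have "child_index G v < child_index G w" if "v \<in> children G u" "w \<in> children G u" "v < w" for v w
  proof -
    have e: "(u, v) \<in> edges G" "(u, w) \<in> edges G" using that by (auto simp: children_def)
    have "{x \<in> children G u. x < v} \<subset> {x \<in> children G u. x < w}" using that by auto
    then show ?thesis
      unfolding e[THEN child_index_child] by (intro psubset_card_mono) (simp add: finite_children)
  qed
  then have inj: "inj_on (child_index G) (children G u)"
    by (intro inj_onI) (metis less_irrefl linorder_less_linear)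
  have "child_index G ` children G u = {..<d}"
    by (rule card_subset_eq) (use child_index_less assms card_image[OF inj] in auto)
  then show ?thesis using inj unfolding bij_betw_def by blast
qed

text \<open>The parent edge of an ancestor at distance less than \<open>t\<close> lies in the ball,
  so a missing one reveals the true root and the virtual continuation is the same.\<close>

lemma ball_anc:
  assumes "v \<in> nodes G" "i \<le> t"
  shows "ancestors B K (induced G (ball G v t)) v i = anc v i \<and> (anc v i \<in> ball G v i \<or> B < anc v i)"
  using assms(2)
proof (induction i)
  case 0
  then show ?case by (simp add: ancestors_def ball_self)
next
  case (Suc i)
  define H where "H = induced G (ball G v t)"
  define u where "u = anc v i"
  have IH: "ancestors B K H v i = u" "u \<in> ball G v i \<or> B < u" using Suc unfolding H_def u_def by auto
  have edges_eq: "(a, u) \<in> edges H \<longleftrightarrow> (a, u) \<in> edges G" for a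
  proof
    assume a: "(a, u) \<in> edges G"
    then have "u \<in> ball G v i" using IH(2) edge_bounds by fastforce
    moreover from this have "a \<in> ball G v (Suc i)" by (rule ball_step) (use a in simp)
    ultimately show "(a, u) \<in> edges H"
      using a Suc.prems ball_mono[of i t G v] ball_mono[of "Suc i" t G v] unfolding H_def induced_def by auto
  qed (simp add: H_def induced_def)
  have "ancestors B K H v (Suc i) = par u"
    using IH(1) edges_eq by (simp add: ancestors_def tree_parent_def)
  moreover have "par u \<in> ball G v (Suc i) \<or> B < par u"
  proof (cases "u \<le> B")
    case True
    then show ?thesis using IH(2) par_real[OF True] ball_step[of u G v i "par u"] by auto
  next
    case False
    then show ?thesis using par_virtual by simp
  qed
  ultimately show ?case unfolding H_def u_def by (simp add: anc_Suc)
qed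

text \<open>Siblings of the ancestor at distance \<open>i\<close> are reached within
  \<open>i + 2\<close> steps.\<close>

lemma ball_child_index:
  assumes "v \<in> nodes G" "i + 2 \<le> t"
  shows "child_index (induced G (ball G v t)) (anc v i) = child_index G (anc v i)"
proof (cases "B < anc v i")
  case True
  then have "(p, anc v i) \<notin> edges G" for p using edge_bounds by fastforce
  then show ?thesis unfolding child_index_def induced_def by simp
next
  case False
  then have u: "anc v i \<in> ball G v i" using ball_anc[OF assms(1), of i i] by simp
  have "p \<in> ball G v t \<and> w \<in> ball G v t" if e: "(p, anc v i) \<in> edges G" "(p, w) \<in> edges G" for p w
  proof -
    have "p \<in> ball G v (Suc i)" by (rule ball_step[OF u]) (use e in simp)
    moreover from this have "w \<in> ball G v (Suc (Suc i))" by (rule ball_step) (use e in simp)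
    ultimately show ?thesis
      using assms(2) ball_mono[of "Suc i" t G v] ball_mono[of "Suc (Suc i)" t G v] by auto
  qed
  moreover have "anc v i \<in> ball G v t" using u assms(2) ball_mono[of i t G v] by auto
  ultimately have "(\<exists>p. (p, anc v i) \<in> edges (induced G (ball G v t)) \<and> (p, w) \<in> edges (induced G (ball G v t))) \<longleftrightarrow>
    (\<exists>p. (p, anc v i) \<in> edges G \<and> (p, w) \<in> edges G)" for w
    unfolding induced_def by auto
  then show ?thesis unfolding child_index_def by simp
qed

context
  fixes P :: "'l lcl" and S :: "'l set" and b b' :: nat
    and leaf :: "nat \<Rightarrow> nat list \<Rightarrow> 'l" and g :: "nat \<Rightarrow> 'l \<Rightarrow> nat list \<Rightarrow> 'l"
  assumes P: "lcl_problem P" "arity P = d"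
    and b: "b \<ge> 1" "b' \<ge> 1" "B + K < 2 ^ b" "(2 * b) ^ K \<le> 2 ^ b'"
    and S: "\<And>D y. D \<in> {K..<2 * K} \<Longrightarrow> y \<in> words (arity P) D \<Longrightarrow> leaf D y \<in> S"
    and g: "\<And>D \<sigma>. D \<in> {K..<2 * K} \<Longrightarrow> \<sigma> \<in> S \<Longrightarrow> g D \<sigma> [] = \<sigma> \<and> piece P D (leaf D) (g D \<sigma>)"
begin

abbreviation "lab \<equiv> tree_label B b b' K leaf g"

lemma sparse_cuts_anc:
  assumes "v \<in> nodes G"
  shows "sparse K (cuts b b' K (anc v))"
  by (rule sparse_cuts[OF locally_distinct_anc[OF assms]])
    (use anc_le[OF assms] b K le_less_trans in \<open>blast+\<close>)

text \<open>Cuts below \<open>6 * K\<close> look at fewer than \<open>8 * K\<close> ancestors beyond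
  the greedy reach, and child indices need two more steps than their ancestor; \<open>10 * K\<close>
  covers both.\<close>

lemma tree_label_ball:
  assumes "v \<in> nodes G" "t = 2 * (2 * b') ^ K * K + 10 * K"
  shows "lab (induced G (ball G v t)) v = lab G v"
  unfolding tree_label_def
proof (rule piece_label_cong[OF sparse_cuts_anc[OF assms(1)] K])
  fix c assume "c < 6 * K"
  then show "c \<in> cuts b b' K (anc v) \<longleftrightarrow> c \<in> cuts b b' K (ancestors B K (induced G (ball G v t)) v)"
    using ball_anc[OF assms(1)] assms(2) by (intro cuts_cong[OF K refl]) simp
next
  fix i assume "i < 6 * K"
  then show "child_index G (anc v i) =
    child_index (induced G (ball G v t)) (ancestors B K (induced G (ball G v t)) v i)"
    using ball_anc[OF assms(1), of i t] ball_child_index[OF assms(1), of i t] assms(2) K by simp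
qed

lemma tree_label_step:
  assumes u: "u \<in> nodes G"
  shows "\<exists>h. allowed P (lab G u) h \<and> (\<forall>v\<in>children G u. lab G v = h (child_index G v))"
proof -
  have "child_index G (anc u i) < arity P" for i using child_index_less P(2) by simp
  then obtain h where h: "allowed P (lab G u) h"
    "\<And>C' idx'. sparse K C' \<Longrightarrow> (\<And>m. Suc m \<in> C' \<longleftrightarrow> m \<in> cuts b b' K (anc u)) \<Longrightarrow>
      (\<And>i. idx' (Suc i) = child_index G (anc u i)) \<Longrightarrow> idx' 0 < arity P \<Longrightarrow>
      piece_label K leaf g C' idx' = h (idx' 0)"
    using piece_label_step[OF K sparse_cuts_anc[OF u] S g, of "\<lambda>i. child_index G (anc u i)"]
    unfolding tree_label_def by blast
  have "lab G v = h (child_index G v)" if "v \<in> children G u" for v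
  proof -
    have e: "(u, v) \<in> edges G" using that by (simp add: children_def)
    have "lab G v = h (child_index G (anc v 0))"
      unfolding tree_label_def
    proof (rule h(2))
      show "sparse K (cuts b b' K (anc v))" using sparse_cuts_anc edge_bounds[OF e] by blast
      show "Suc m \<in> cuts b b' K (anc v) \<longleftrightarrow> m \<in> cuts b b' K (anc u)" for m
        by (rule cuts_Suc) (rule anc_child[OF e])
      show "child_index G (anc v (Suc i)) = child_index G (anc u i)" for i
        using anc_child[OF e] by simp
      show "child_index G (anc v 0) < arity P" using child_index_less P(2) by simp
    qed
    then show ?thesis by (simp add: anc_0)
  qed
  then show ?thesis using h(1) by blast
qed

lemma feasible_tree_label: "feasible P G (lab G)"
  unfolding feasible_def
proof (intro conjI ballI impI)
  fix u assume u: "u \<in> nodes G"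
  obtain h where h: "allowed P (lab G u) h" "\<And>v. v \<in> children G u \<Longrightarrow> lab G v = h (child_index G v)"
    using tree_label_step[OF u] by blast
  show "lab G u \<in> labels P" by (rule allowed_labels(1)[OF P(1) h(1)])
  assume "card (children G u) = arity P"
  then have bij: "bij_betw (child_index G) (children G u) {..<d}" using bij_betw_child_index P(2) by simp
  obtain cs where cs: "distinct cs" "set cs = {..<d}" "(lab G u, map h cs) \<in> configs P"
    using h(1) P(2) unfolding allowed_def by auto
  \<comment> \<open>The inverse of the child index turns an order of the indices into an order of
    the children.\<close>
  define f where "f = the_inv_into (children G u) (child_index G)"
  have bij': "bij_betw f {..<d} (children G u)" unfolding f_def by (rule bij_betw_the_inv_into[OF bij])
  have "lab G (f c) = h c" if "c \<in> set cs" for c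
    using h(2) that cs(2) bij' f_the_inv_into_f_bij_betw[OF bij] unfolding f_def
    by (metis bij_betw_apply)
  then have "map (lab G) (map f cs) = map h cs" by simp
  moreover have "distinct (map f cs)" "set (map f cs) = children G u"
    using cs(1,2) bij' unfolding bij_betw_def by (auto simp: distinct_map)
  ultimately show "\<exists>us. distinct us \<and> set us = children G u \<and> (lab G u, map (lab G) us) \<in> configs P"
    using cs(3) by metis
qed

end

end

lemma solves_local_tree_label:
  assumes P: "lcl_problem P" and K: "K \<ge> 1"
    and cert: "\<And>D. D \<in> {K..<2 * K} \<Longrightarrow> certificate P S D"
    and b: "\<And>n. b n \<ge> 1" "\<And>n. b' n \<ge> 1" "\<And>n. id_bound n + K < 2 ^ b n" "\<And>n. (2 * b n) ^ K \<le> 2 ^ b' n"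
  shows "\<exists>A. solves_local id_bound P (\<lambda>n. 2 * (2 * b' n) ^ K * K + 10 * K) A"
proof -
  have "\<forall>D\<in>{K..<2 * K}. \<exists>leaf. (\<forall>y\<in>words (arity P) D. leaf y \<in> S) \<and> (\<forall>\<sigma>\<in>S. \<exists>g. g [] = \<sigma> \<and> piece P D leaf g)"
    using cert unfolding certificate_def by blast
  then obtain leaf where leaf: "\<forall>D\<in>{K..<2 * K}. (\<forall>y\<in>words (arity P) D. leaf D y \<in> S) \<and>
      (\<forall>\<sigma>\<in>S. \<exists>g. g [] = \<sigma> \<and> piece P D (leaf D) g)"
    by (rule bchoice[THEN exE])
  define g where "g = (\<lambda>D \<sigma>. SOME g. g [] = \<sigma> \<and> piece P D (leaf D) g)"
  have g: "g D \<sigma> [] = \<sigma> \<and> piece P D (leaf D) (g D \<sigma>)" if "D \<in> {K..<2 * K}" "\<sigma> \<in> S" for D \<sigma>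
  proof -
    have "\<exists>g. g [] = \<sigma> \<and> piece P D (leaf D) g" using leaf that by blast
    then show ?thesis unfolding g_def by (rule someI_ex)
  qed
  have S: "leaf D y \<in> S" if "D \<in> {K..<2 * K}" "y \<in> words (arity P) D" for D y
    using leaf that by blast
  define A where "A = (\<lambda>n v G. tree_label (id_bound n) (b n) (b' n) K leaf g G v)"
  have "solves_local id_bound P (\<lambda>n. 2 * (2 * b' n) ^ K * K + 10 * K) A"
    unfolding solves_local_def
  proof (intro allI impI)
    fix G :: "nat graph" and ident
    assume reg: "regular_tree (arity P) G" and inj: "inj_on ident (nodes G)"
      and ids: "ident ` nodes G \<subseteq> {1..id_bound (card (nodes G))}"
    define n where "n = card (nodes G)"
    define t where "t = 2 * (2 * b' n) ^ K * K + 10 * K"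
    define G' where "G' = rename ident G"
    have GE: "edges G \<subseteq> nodes G \<times> nodes G" using reg rooted_treeD(2) unfolding regular_tree_def by blast
    interpret id_tree "arity P" "id_bound n" K G'
      by unfold_locales (use regular_tree_rename[OF inj reg] ids K P in \<open>auto simp: G'_def n_def lcl_problem_def\<close>)
    have "feasible P G' (tree_label (id_bound n) (b n) (b' n) K leaf g G')"
      by (rule feasible_tree_label[OF P refl b(1,2,3,4) S g])
    then have "feasible P G (tree_label (id_bound n) (b n) (b' n) K leaf g G' \<circ> ident)"
      unfolding G'_def by (rule feasible_rename[OF inj GE])
    moreover have "local_output A t G ident v = (tree_label (id_bound n) (b n) (b' n) K leaf g G' \<circ> ident) v"
      if v: "v \<in> nodes G" for v
    proof -
      have "rename ident (induced G (ball G v t)) = induced G' (ball G' (ident v) t)"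
        unfolding G'_def ball_rename[OF inj GE v]
        by (rule induced_rename[OF inj GE ball_subset_nodes[OF GE v], symmetric])
      moreover have "tree_label (id_bound n) (b n) (b' n) K leaf g (induced G' (ball G' (ident v) t)) (ident v) =
        tree_label (id_bound n) (b n) (b' n) K leaf g G' (ident v)"
        by (rule tree_label_ball[OF P refl b(1,2,3,4) S g _ t_def]) (use v in \<open>auto simp: G'_def\<close>)
      ultimately show ?thesis unfolding local_output_def A_def n_def[symmetric] by simp
    qed
    ultimately have "feasible P G (local_output A t G ident)"
      using feasible_cong[OF _ GE] by blast
    then show "feasible P G (local_output A (2 * (2 * b' (card (nodes G))) ^ K * K + 10 * K) G ident)"
      unfolding t_def n_def .
  qed
  then show ?thesis by blast
qed

section \<open>Asymptotics\<close>

lemma exists_binary_length: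
  fixes x :: nat
  assumes "x \<ge> 1"
  shows "\<exists>b\<ge>1. x < 2 ^ b \<and> real b * ln 2 \<le> ln (2 * real x)"
proof -
  obtain b where b: "2 ^ b \<le> x" "x < 2 ^ (b + 1)" using ex_power_ivl1[of 2 x] assms by auto
  have "real (2 ^ (b + 1)) \<le> 2 * real x" using b(1) by (simp flip: of_nat_power)
  then have "ln (real (2 ^ (b + 1))) \<le> ln (2 * real x)" using assms by (intro ln_mono) auto
  moreover have "ln (real (2 ^ (b + 1))) = real (b + 1) * ln 2"
    unfolding of_nat_power by (simp add: ln_realpow del: power_Suc)
  ultimately have "real (b + 1) * ln 2 \<le> ln (2 * real x)" by simp
  then show ?thesis using b(2) by (intro exI[of _ "b + 1"]) auto
qed

text \<open>\<open>b\<close> is logarithmic in \<open>n\<close> because \<open>id_bound\<close> is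
  polynomial, and \<open>b'\<close> is logarithmic in \<open>b\<close> because \<open>K\<close> is
  constant.\<close>

lemma iterated_logarithm_bounds:
  assumes K: "K \<ge> 1" and id: "(\<lambda>n. real (id_bound n)) \<in> O(\<lambda>n. real n ^ k)"
  obtains b b' :: "nat \<Rightarrow> nat" where "\<And>n. b n \<ge> 1" "\<And>n. b' n \<ge> 1"
    "\<And>n. id_bound n + K < 2 ^ b n" "\<And>n. (2 * b n) ^ K \<le> 2 ^ b' n"
    "(\<lambda>n. real (b' n)) \<in> O(\<lambda>n. ln (ln (real n)))"
proof -
  have "\<exists>b\<ge>1. id_bound n + K < 2 ^ b \<and> real b * ln 2 \<le> ln (2 * real (id_bound n + K))" for n
    using exists_binary_length[of "id_bound n + K"] K by simp
  then obtain b where b: "\<And>n. b n \<ge> 1" "\<And>n. id_bound n + K < 2 ^ b n"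
    "\<And>n. real (b n) * ln 2 \<le> ln (2 * real (id_bound n + K))" by metis
  have "\<exists>b'\<ge>1. (2 * b n) ^ K < 2 ^ b' \<and> real b' * ln 2 \<le> ln (2 * real ((2 * b n) ^ K))" for n
    using exists_binary_length[of "(2 * b n) ^ K"] b(1)[of n] by simp
  then obtain b' where b': "\<And>n. b' n \<ge> 1" "\<And>n. (2 * b n) ^ K < 2 ^ b' n"
    "\<And>n. real (b' n) * ln 2 \<le> ln (2 * real ((2 * b n) ^ K))" by metis
  obtain c where c: "c > 0" "\<forall>\<^sub>F n in sequentially. real (id_bound n) \<le> c * real n ^ k"
    using id by (auto elim!: landau_o.bigE)
  define c' where "c' = 2 * (real k + 1) / ln 2"
  have "c' > 0" unfolding c'_def by simp
  have "\<forall>\<^sub>F n in sequentially. 2 * (c + real K) \<le> real n"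
    by real_asymp
  with c(2) have ev: "\<forall>\<^sub>F n in sequentially. 2 * real (b n) \<le> c' * ln (real n)"
    using eventually_ge_at_top[of 1]
  proof eventually_elim
    case (elim n)
    have "2 * real (id_bound n + K) \<le> 2 * (c + real K) * real n ^ k"
    proof -
      have "1 \<le> real n ^ k" using elim(3) by (intro one_le_power) simp
      then have "real K \<le> real K * real n ^ k" using mult_left_mono[of 1 "real n ^ k" "real K"] by simp
      then show ?thesis using elim(1) by (simp add: algebra_simps)
    qed
    also have "\<dots> \<le> real n * real n ^ k" using elim(2) by (intro mult_right_mono) auto
    finally have "ln (2 * real (id_bound n + K)) \<le> ln (real n ^ (k + 1))"
      using K by (intro ln_mono) auto
    also have "\<dots> = (real k + 1) * ln (real n)" using elim(3) by (simp add: ln_realpow del: power_Suc)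
    finally have "real (b n) * ln 2 \<le> (real k + 1) * ln (real n)" using b(3)[of n] by linarith
    then show ?case unfolding c'_def by (simp add: field_simps)
  qed
  \<comment> \<open>The \<open>K + 1\<close> extra copies of \<open>ln (ln n)\<close> absorb the
    constants \<open>ln 2\<close> and \<open>K * ln c'\<close>.\<close>
  have "\<forall>\<^sub>F n in sequentially. ln 2 + real K * ln (c' * ln (real n)) \<le> (2 * real K + 1) * ln (ln (real n))"
    using \<open>c' > 0\<close> K by real_asymp
  with ev have "\<forall>\<^sub>F n in sequentially. norm (real (b' n)) \<le> ((2 * real K + 1) / ln 2) * norm (ln (ln (real n)))"
  proof eventually_elim
    case (elim n)
    have "ln (2 * real ((2 * b n) ^ K)) = ln 2 + real K * ln (2 * real (b n))"
    proof -
      have "2 * real (b n) > 0" using b(1)[of n] by simp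
      have "ln ((2 * real (b n)) ^ K) = real K * ln (2 * real (b n))" by (rule ln_realpow)
      moreover have "real ((2 * b n) ^ K) = (2 * real (b n)) ^ K" by simp
      moreover have "(2 * real (b n)) ^ K > 0" using \<open>2 * real (b n) > 0\<close> by simp
      ultimately show ?thesis by (simp only: ln_mult_pos)
    qed
    also have "\<dots> \<le> ln 2 + real K * ln (c' * ln (real n))"
      using elim(1) b(1)[of n] by (intro add_left_mono mult_left_mono ln_mono) auto
    also have "\<dots> \<le> (2 * real K + 1) * ln (ln (real n))" by (rule elim(2))
    finally have "real (b' n) * ln 2 \<le> (2 * real K + 1) * ln (ln (real n))" using b'(3)[of n] by linarith
    then have "real (b' n) \<le> ((2 * real K + 1) / ln 2) * ln (ln (real n))" by (simp add: field_simps)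
    also have "\<dots> \<le> ((2 * real K + 1) / ln 2) * norm (ln (ln (real n)))"
      by (intro mult_left_mono) auto
    finally show ?case by simp
  qed
  then have "(\<lambda>n. real (b' n)) \<in> O(\<lambda>n. ln (ln (real n)))" by (rule bigoI)
  then show ?thesis by (rule that[OF b(1) b'(1) b(2) less_imp_le[OF b'(2)]])
qed

text \<open>With \<open>y = ln (ln n)\<close>, the core of the claim is that \<open>y ^ K\<close> is
  negligible against \<open>exp y\<close>.\<close>

lemma loglog_power_smallo:
  assumes "(\<lambda>n. real (b' n)) \<in> O(\<lambda>n. ln (ln (real n)))"
  shows "(\<lambda>n. real (2 * (2 * b' n) ^ K * K + 10 * K)) \<in> o(\<lambda>n. ln (real n))"
proof -
  have "((\<lambda>n. ln (ln (real n)) ^ K / exp (ln (ln (real n)))) \<longlongrightarrow> 0) sequentially"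
    by (rule filterlim_compose[OF tendsto_power_div_exp_0]) real_asymp
  moreover have "\<forall>\<^sub>F n in sequentially. ln (ln (real n)) ^ K / exp (ln (ln (real n))) = ln (ln (real n)) ^ K / ln (real n)"
    using eventually_ge_at_top[of 2] by eventually_elim simp
  ultimately have "((\<lambda>n. ln (ln (real n)) ^ K / ln (real n)) \<longlongrightarrow> 0) sequentially"
    by (rule Lim_transform_eventually)
  moreover have "\<forall>\<^sub>F n in sequentially. ln (real n) \<noteq> 0"
    using eventually_ge_at_top[of 2] by eventually_elim simp
  ultimately have "(\<lambda>n. ln (ln (real n)) ^ K) \<in> o(\<lambda>n. ln (real n))" by (intro smalloI_tendsto)
  then have 1: "(\<lambda>n. real (b' n) ^ K) \<in> o(\<lambda>n. ln (real n))"
    using landau_o.big_power[OF assms, of K] landau_o.big_small_trans by blast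
  have 2: "(\<lambda>n. 10 * real K) \<in> o(\<lambda>n. ln (real n))" by real_asymp
  have "(\<lambda>n. (2 ^ Suc K * real K) * real (b' n) ^ K) \<in> o(\<lambda>n. ln (real n))"
    by (cases "K = 0") (use 1 in auto)
  from sum_in_smallo(1)[OF this 2] show ?thesis
    by (simp add: power_mult_distrib mult_ac)
qed

section \<open>Equivalence of the logarithmic lower bounds\<close>

theorem theorem5p4:
  fixes P :: "'l lcl" and id_bound :: "nat \<Rightarrow> nat"
  assumes "lcl_problem P"
    and "\<And>n. n \<le> id_bound n"
    and "\<exists>k. (\<lambda>n. real (id_bound n)) \<in> O(\<lambda>n. real n ^ k)"
  shows "Omega_log (input_sizes P) (local_locality id_bound P) \<longleftrightarrow>
         Omega_log (input_sizes P) (online_locality P)"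
proof
  assume "Omega_log (input_sizes P) (online_locality P)"
  then obtain c where c: "c > 0" "\<forall>\<^sub>F n in sequentially. n \<in> input_sizes P \<longrightarrow>
      ereal (c * ln (real n)) \<le> ereal_of_enat (online_locality P n)"
    unfolding Omega_log_def by blast
  have le: "ereal_of_enat (online_locality P n) \<le> ereal_of_enat (local_locality id_bound P n)" for n
    using online_locality_le_local_locality[OF assms(2)] by simp
  from c(2) have "\<forall>\<^sub>F n in sequentially. n \<in> input_sizes P \<longrightarrow>
      ereal (c * ln (real n)) \<le> ereal_of_enat (local_locality id_bound P n)"
    by eventually_elim (use le order_trans in blast)
  with c(1) show "Omega_log (input_sizes P) (local_locality id_bound P)"
    unfolding Omega_log_def by blast
next
  assume loc: "Omega_log (input_sizes P) (local_locality id_bound P)"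
  show "Omega_log (input_sizes P) (online_locality P)"
  proof (rule ccontr)
    assume not_online: "\<not> Omega_log (input_sizes P) (online_locality P)"
    \<comment> \<open>Without any online algorithm the locality is infinite and the lower bound is
      trivial.\<close>
    have "\<exists>T A. solves_online P T A"
    proof (rule ccontr)
      assume "\<not> ?thesis"
      then have "{T. \<exists>A. solves_online P T A} = {}" by blast
      then have "online_locality P n = \<infinity>" for n
        unfolding online_locality_def by (simp only: image_empty Inf_empty top_enat_def)
      then have "Omega_log (input_sizes P) (online_locality P)"
        unfolding Omega_log_def by (intro exI[of _ 1]) simp
      then show False using not_online by simp
    qed
    then obtain T A where sol: "solves_online P T A" and T: "\<And>n. online_locality P n = enat (T n)"
      using online_locality_attained by metis
    have freq: "\<exists>\<^sub>F n in sequentially. n \<in> input_sizes P \<and> real (T n) < c * ln (real n)" if "c > 0" for c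
    proof -
      have "\<not> (\<forall>\<^sub>F n in sequentially. n \<in> input_sizes P \<longrightarrow> ereal (c * ln (real n)) \<le> ereal_of_enat (online_locality P n))"
        using not_online that unfolding Omega_log_def by blast
      then show ?thesis unfolding T not_eventually by (simp add: not_le)
    qed
    define d where "d = arity P"
    have d: "d \<ge> 1" using assms(1) unfolding lcl_problem_def d_def by simp
    define M where "M = 320 * 2 ^ card (labels P) * d ^ 10"
    have "0 < 2 ^ card (labels P) * d ^ 10" using d by simp
    then have "M > 1" unfolding M_def by linarith
    then have lnM: "ln (real M) > 0" by simp
    \<comment> \<open>The constant gives \<open>T n * ln M \<le> ln n / 2\<close>, and
      \<open>M ^ 2 \<le> n\<close> pays for one more factor, so that
      \<open>M ^ (T n + 1) \<le> n\<close>. A single such \<open>n\<close> suffices: its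
      certificates yield a LOCAL algorithm for inputs of every size.\<close>
    have "\<exists>\<^sub>F n in sequentially. (n \<in> input_sizes P \<and> real (T n) < 1 / (2 * ln (real M)) * ln (real n)) \<and> M\<^sup>2 \<le> n"
      by (rule frequently_eventually_frequently[OF freq eventually_ge_at_top]) (use lnM in simp)
    then obtain n where n: "n \<in> input_sizes P" "real (T n) < 1 / (2 * ln (real M)) * ln (real n)" "M\<^sup>2 \<le> n"
      using frequently_ex by blast
    define K where "K = 2 * T n + 2"
    have "M ^ (T n + 1) \<le> n"
    proof -
      have "n > 0" using n(3) \<open>M > 1\<close> by (metis gr0I not_one_less_zero le_zero_eq power_eq_0_iff)
      have "real (T n) * ln (real M) \<le> ln (real n) / 2" using n(2) lnM by (simp add: field_simps)
      moreover have "2 * ln (real M) \<le> ln (real n)"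
      proof -
        have "2 * ln (real M) = ln (real (M\<^sup>2))" using \<open>M > 1\<close> by (simp add: ln_realpow)
        also have "\<dots> \<le> ln (real n)" using n(3) \<open>M > 1\<close> by (intro ln_mono) (auto simp flip: of_nat_power)
        finally show ?thesis .
      qed
      ultimately have "ln (real (M ^ (T n + 1))) \<le> ln (real n)"
        using \<open>M > 1\<close> by (simp add: ln_realpow ln_mult algebra_simps)
      then have "real (M ^ (T n + 1)) \<le> real n"
        using \<open>M > 1\<close> \<open>n > 0\<close> by (subst (asm) ln_le_cancel_iff) auto
      then show ?thesis by linarith
    qed
    moreover define N where "N = 2 ^ card (labels P) * arity P ^ (2 * K) + 1"
    ultimately have "card (spine_tree (arity P) (2 * K + N * K) (3 * K)) \<le> n"
      using spine_tree_size_bound[OF d[unfolded d_def] K_def N_def] unfolding M_def d_def by linarith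
    then obtain S where S: "\<And>D. D \<in> {K..<2 * K} \<Longrightarrow> certificate P S D"
      using online_certificate[OF assms(1) sol n(1) K_def N_def] by blast
    have "K \<ge> 1" unfolding K_def by simp
    obtain k where k: "(\<lambda>n. real (id_bound n)) \<in> O(\<lambda>n. real n ^ k)" using assms(3) by blast
    obtain b b' :: "nat \<Rightarrow> nat" where b: "\<And>n. b n \<ge> 1" "\<And>n. b' n \<ge> 1"
      "\<And>n. id_bound n + K < 2 ^ b n" "\<And>n. (2 * b n) ^ K \<le> 2 ^ b' n"
      and small: "(\<lambda>n. real (b' n)) \<in> O(\<lambda>n. ln (ln (real n)))"
      by (rule iterated_logarithm_bounds[OF \<open>K \<ge> 1\<close> k]) blast
    define t where "t = (\<lambda>n. 2 * (2 * b' n) ^ K * K + 10 * K)"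
    have "\<exists>A'. solves_local id_bound P t A'"
      unfolding t_def by (rule solves_local_tree_label[OF assms(1) \<open>K \<ge> 1\<close>, of S b]) (use S b in auto)
    then obtain A' where "solves_local id_bound P t A'" by blast
    then have le: "local_locality id_bound P n \<le> enat (t n)" for n
      unfolding local_locality_def by (intro INF_lower) blast
    obtain c where c: "c > 0"
      "\<forall>\<^sub>F n in sequentially. n \<in> input_sizes P \<longrightarrow> ereal (c * ln (real n)) \<le> ereal_of_enat (local_locality id_bound P n)"
      using loc unfolding Omega_log_def by blast
    have "\<forall>\<^sub>F n in sequentially. norm (real (t n)) \<le> c / 2 * norm (ln (real n))"
      using landau_o.smallD[OF loglog_power_smallo[OF small, of K], of "c / 2"] c(1) unfolding t_def by simp
    \<comment> \<open>The lower bound and the locality \<open>o(log n)\<close> just obtained exclude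
      all large input sizes, whereas \<open>freq\<close> provides infinitely many.\<close>
    with c(2) have "\<forall>\<^sub>F n in sequentially. n \<notin> input_sizes P"
      using eventually_ge_at_top[of 2]
    proof eventually_elim
      case (elim n)
      have "real (t n) < c * ln (real n)"
      proof -
        have "real (t n) \<le> c / 2 * ln (real n)" using elim(2,3) by simp
        moreover have "0 < c * ln (real n)" using c(1) elim(3) by simp
        ultimately show ?thesis by simp
      qed
      moreover have "ereal_of_enat (local_locality id_bound P n) \<le> ereal (real (t n))"
        using le[of n] by (metis ereal_of_enat_le_iff ereal_of_enat_simps(1))
      ultimately show ?case using elim(1) by (auto dest: order_trans)
    qed
    then have "\<not> (\<exists>\<^sub>F n in sequentially. n \<in> input_sizes P \<and> real (T n) < 1 * ln (real n))"
      unfolding not_frequently by eventually_elim simp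
    then show False using freq[of 1] by simp
  qed
qed

end
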